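(* In the setting and notation of the context, assume that for every $b\in\mathbb{B}$ $$((\epsilon_0\otimes\ell)\rho\otimes \mathrm{id})(\pi_{\mathcal{E}}\tau_2\otimes \pi_{\mathfrak{B}})\underline{\Delta}(\mathtt{b})=(\pi_{\mathcal{E}}\tau_2\otimes \pi_{\mathfrak{B}})\underline{\Delta}(\mathtt{b})$$ and $$[\epsilon_0\pi_{\mathcal{E}}\tau_2\otimes ((\pi_{\mathcal{E}}\tau_2\otimes \pi_{\mathfrak{B}})\underline{\Delta}\tau_1)]\underline{\Delta}(\mathtt{b})=0 .$$ Let $\omega\colon\mathfrak{B}\to\mathcal{E}$ be the linear map defined on the basis $\mathbb{B}$ by $$\omega(b)=\ell(b)-(\epsilon_0\otimes\ell)(\pi_{\mathcal{E}}\tau_2\otimes \pi_{\mathfrak{B}})\underline{\Delta}(\mathtt{b}).$$ If $\omega$ is $H$-linear, then $\sigma\colon\mathfrak{B}\otimes\mathfrak{B}\to\Bbbk$, $\sigma(a,b)=\epsilon_0(\omega(a)\omega(b))$, belongs to $Z^2(\mathfrak{B})^H$, and $\mathcal{E}\simeq\mathfrak{B}_{(\sigma)}$.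
   Context: $\Bbbk$ is an algebraically closed field of characteristic zero and $H$ is a Hopf algebra over $\Bbbk$ with bijective antipode; ${}^H_H\mathcal{YD}$ is the braided category of Yetter–Drinfeld modules, with coaction $v\mapsto v_{(-1)}\otimes v_{(0)}$ and braiding $c(v\otimes w)=v_{(-1)}\cdot w\otimes v_{(0)}$. $(V,c)$ is a braided vector space with basis $x_1,\dots,x_\theta$ realized in ${}^H_H\mathcal{YD}$, and $\mathfrak{B}=\mathfrak{B}(V)$ is its Nichols algebra. Tensor products of algebras/coalgebras are braided; in particular $\mathfrak{B}\otimes\mathfrak{B}$ is a coalgebra with $\Delta(a\otimes b)=\big(a_{(1)}\otimes a_{(2)(-1)}\cdot b_{(1)}\big)\otimes\big(a_{(2)(0)}\otimes b_{(2)}\big)$, and convolution products of maps on $\mathfrak{B}\otimes\mathfrak{B}$ are taken with respect to it. Cleft objects. A (right) cleft object for $\mathfrak{B}$ in $H$-mod is a right $\mathfrak{B}$-comodule algebra $\mathcal{E}$ in $H$-mod, with coaction $\rho\colon\mathcal{E}\to\mathcal{E}\otimes\mathfrak{B}$, with coinvariants $\Bbbk$, and for which there is a convolution-invertible comodule isomorphism $\gamma\colon\mathfrak{B}\to\mathcal{E}$ in $H$-mod. A convolution-invertible comodule isomorphism $\gamma$ with $\gamma(1)=1$ is called a section. $\mathrm{Cleft}_H(\mathfrak{B})$ is the set of isoclasses of such cleft objects. Cocycles. $Z^2(\mathfrak{B})^H$ is the set of convolution-invertible linear maps $\sigma\colon\mathfrak{B}\otimes\mathfrak{B}\to\Bbbk$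 with $\sigma(h_{(1)}\cdot a,h_{(2)}\cdot b)=\epsilon(h)\sigma(a,b)$ ($H$-linearity), $\sigma(x,1)=\epsilon(x)=\sigma(1,x)$, and $\sigma(x_{(1)},y_{(1)})\sigma(x_{(2)}y_{(2)},z)=\sigma(y_{(1)},z_{(1)})\sigma(x,y_{(2)}z_{(2)})$, where $x_{(1)}\otimes y_{(1)}\otimes x_{(2)}\otimes y_{(2)}$ denotes the braided coproduct of $x\otimes y$. $\mathfrak{B}_{(\sigma)}$ is the comodule algebra with underlying space $\mathfrak{B}$, product $\sigma\ast m$ (convolution with the multiplication $m$ of $\mathfrak{B}$), and coaction $\Delta$. Fixed data. $\mathcal{E}\in\mathrm{Cleft}_H(\mathfrak{B})$ with coaction $\rho$; a pre-Nichols algebra $\hat{\mathfrak{B}}$ of $V$ (an intermediate graded braided Hopf algebra quotient $T(V)\twoheadrightarrow\hat{\mathfrak{B}}\twoheadrightarrow\mathfrak{B}$) with canonical projection $\pi_{\mathfrak{B}}\colon\hat{\mathfrak{B}}\to\mathfrak{B}$, $\mathfrak{J}=\ker\pi_{\mathfrak{B}}$; an algebra projection $\pi_{\mathcal{E}}\colon\hat{\mathfrak{B}}\to\mathcal{E}$ with $\rho\pi_{\mathcal{E}}=(\pi_{\mathcal{E}}\otimes\pi_{\mathfrak{B}})\Delta_{\hat{\mathfrak{B}}}$. The generators of $\hat{\mathfrak{B}}$ are written $\mathtt{x}_1,\dots,\mathtt{x}_\theta$ and their images in $\mathcal{E}$ are $y_1,\dots,y_\theta$. $\mathbb{B}$ is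 a homogeneous basis of $\mathfrak{B}$, whose elements are $b=p_b(x_1,\dots,x_\theta)$ for fixed homogeneous noncommutative polynomials $p_b$; the elements $p_b(y_1,\dots,y_\theta)$, $b\in\mathbb{B}$, form a basis of $\mathcal{E}$. $\ell\colon\mathfrak{B}\to\mathcal{E}$ is the linear isomorphism with $\ell(b)=p_b(y_1,\dots,y_\theta)$, and $\epsilon_0\colon\mathcal{E}\to\Bbbk$ is the linear map with $\epsilon_0\ell=\epsilon_{\mathfrak{B}}$. For $b\in\mathbb{B}$ set $\mathtt{b}=p_b(\mathtt{x}_1,\dots,\mathtt{x}_\theta)\in\hat{\mathfrak{B}}$; the linear map $\iota\colon\mathfrak{B}\to\hat{\mathfrak{B}}$, $b\mapsto\mathtt{b}$, gives $\hat{\mathfrak{B}}=\iota(\mathfrak{B})\oplus\mathfrak{J}$, with linear projections $\tau_1\colon\hat{\mathfrak{B}}\to\iota(\mathfrak{B})$ and $\tau_2\colon\hat{\mathfrak{B}}\to\mathfrak{J}$. $\underline{\Delta}(a)=\Delta(a)-a\otimes1-1\otimes a$ for homogeneous $a$ of positive degree, and $\underline{\Delta}=0$ in degree $0$. Tensor factors $\Bbbk$ are identified away ($\Bbbk\otimes X\simeq X$); e.g. $\epsilon_0\otimes\ell$ is regarded as a map $\mathcal{E}\otimes\mathfrak{B}\to\mathcal{E}$. *)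

theory Defs
  imports
    "HOL-Computational_Algebra.Polynomial"
    "HOL-Library.Function_Algebras"
    "HOL-Library.Poly_Mapping"
begin

section \<open>Vector spaces and tensor products\<close>

text \<open>
  Vector spaces live on whole types; a record carries the scalar multiplication and the
  further operations, while addition comes from the class \<open>ab_group_add\<close>.
\<close>

record ('k, 'a) vect =
  scale :: "'k \<Rightarrow> 'a \<Rightarrow> 'a"

definition vspace :: "('k::field, 'a::ab_group_add, 'm) vect_scheme \<Rightarrow> bool" where
  "vspace A \<longleftrightarrow> vector_space (scale A)"

definition lin :: "('k::field, 'a::ab_group_add, 'm) vect_scheme
    \<Rightarrow> ('k, 'b::ab_group_add, 'n) vect_scheme \<Rightarrow> ('a \<Rightarrow> 'b) \<Rightarrow> bool" where
  "lin A B f \<longleftrightarrow> Vector_Spaces.linear (scale A) (scale B) f"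

definition bilin :: "('k::field, 'a::ab_group_add, 'm) vect_scheme
    \<Rightarrow> ('k, 'b::ab_group_add, 'n) vect_scheme \<Rightarrow> ('k, 'c::ab_group_add, 'o) vect_scheme
    \<Rightarrow> ('a \<Rightarrow> 'b \<Rightarrow> 'c) \<Rightarrow> bool" where
  "bilin A B C f \<longleftrightarrow> (\<forall>a. lin B C (f a)) \<and> (\<forall>b. lin A C (\<lambda>a. f a b))"

definition vspan :: "('k::field, 'a::ab_group_add, 'm) vect_scheme \<Rightarrow> 'a set \<Rightarrow> 'a set" where
  "vspan A X = module.span (scale A) X"

definition is_subspace :: "('k::field, 'a::ab_group_add, 'm) vect_scheme \<Rightarrow> 'a set \<Rightarrow> bool" where
  "is_subspace A X \<longleftrightarrow> module.subspace (scale A) X"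

definition indep :: "('k::field, 'a::ab_group_add, 'm) vect_scheme \<Rightarrow> 'a set \<Rightarrow> bool" where
  "indep A X \<longleftrightarrow> \<not> module.dependent (scale A) X"

definition is_basis :: "('k::field, 'a::ab_group_add, 'm) vect_scheme \<Rightarrow> 'a set \<Rightarrow> bool" where
  "is_basis A X \<longleftrightarrow> indep A X \<and> vspan A X = UNIV"

definition family_basis :: "('k::field, 'a::ab_group_add, 'm) vect_scheme
    \<Rightarrow> 'i set \<Rightarrow> ('i \<Rightarrow> 'a) \<Rightarrow> bool" where
  "family_basis A I v \<longleftrightarrow> inj_on v I \<and> is_basis A (v ` I)"

definition ground :: "('k::field, 'k) vect" where
  "ground = \<lparr>scale = (*)\<rparr>"

text \<open>
  \<open>A \<otimes> B\<close> is realized inside the dual of the space of bilinear forms on \<open>A \<times> B\<close>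
  (over a field the canonical map from the tensor product to this dual is injective):
  \<open>a \<otimes> b\<close> is evaluation at \<open>(a, b)\<close>, set to zero on functions that are not bilinear, and
  \<open>A \<otimes> B\<close> is the span of the pure tensors. \<open>TT\<close> is the ambient function space; since
  bilinear forms extend from subspaces, iterated tensor products may be formed over \<open>TT\<close>
  instead of over its subspace \<open>A \<otimes> B\<close>.
\<close>

type_synonym ('k, 'a, 'b) tensor = "('a \<Rightarrow> 'b \<Rightarrow> 'k) \<Rightarrow> 'k"

definition TT :: "('k::field, ('k, 'a, 'b) tensor) vect" where
  "TT = \<lparr>scale = (\<lambda>c t \<beta>. c * t \<beta>)\<rparr>"

definition tens :: "('k::field, 'a::ab_group_add, 'm) vect_scheme
    \<Rightarrow> ('k, 'b::ab_group_add, 'n) vect_scheme \<Rightarrow> 'a \<Rightarrow> 'b \<Rightarrow> ('k, 'a, 'b) tensor" where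
  "tens A B a b = (\<lambda>\<beta>. if bilin A B ground \<beta> then \<beta> a b else 0)"

definition tspace :: "('k::field, 'a::ab_group_add, 'm) vect_scheme
    \<Rightarrow> ('k, 'b::ab_group_add, 'n) vect_scheme \<Rightarrow> ('k, 'a, 'b) tensor set" where
  "tspace A B = vspan TT {tens A B a b | a b. True}"

text \<open>
  \<open>sweedler A B t f\<close> is the value at \<open>t \<in> A \<otimes> B\<close> of the linear map induced by the bilinear
  map \<open>f\<close>, in Sweedler notation \<open>f(t\<^sub>1, t\<^sub>2)\<close>. It does not depend on the chosen
  representation of \<open>t\<close> as a sum of pure tensors (lemma \<open>sweedler_eq\<close>).
\<close>

definition sweedler :: "('k::field, 'a::ab_group_add, 'm) vect_scheme
    \<Rightarrow> ('k, 'b::ab_group_add, 'n) vect_scheme \<Rightarrow> ('k, 'a, 'b) tensor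
    \<Rightarrow> ('a \<Rightarrow> 'b \<Rightarrow> 'c::ab_group_add) \<Rightarrow> 'c" where
  "sweedler A B t f =
     (let ps = (SOME ps. t = (\<Sum>(a, b)\<leftarrow>ps. tens A B a b)) in \<Sum>(a, b)\<leftarrow>ps. f a b)"

definition tmap :: "('k::field, 'a::ab_group_add, 'm) vect_scheme
    \<Rightarrow> ('k, 'b::ab_group_add, 'n) vect_scheme
    \<Rightarrow> ('k, 'c::ab_group_add, 'o) vect_scheme \<Rightarrow> ('k, 'd::ab_group_add, 'p) vect_scheme
    \<Rightarrow> ('a \<Rightarrow> 'c) \<Rightarrow> ('b \<Rightarrow> 'd) \<Rightarrow> ('k, 'a, 'b) tensor \<Rightarrow> ('k, 'c, 'd) tensor" where
  "tmap A B C D f g t = sweedler A B t (\<lambda>a b. tens C D (f a) (g b))"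

lemma vspace_TT: "vspace TT"
  unfolding vspace_def TT_def
  by unfold_locales (auto simp: fun_eq_iff algebra_simps)

lemma vspace_ground: "vspace ground"
  unfolding vspace_def ground_def
  by unfold_locales (auto simp: algebra_simps)

lemma lin_iff:
  "lin A B f \<longleftrightarrow> vspace A \<and> vspace B \<and> (\<forall>x y. f (x + y) = f x + f y)
     \<and> (\<forall>c x. f (scale A c x) = scale B c (f x))"
  unfolding lin_def vspace_def
  by (auto simp: Vector_Spaces.linear_iff_module_hom module_hom_iff
      module_iff_vector_space)

lemma functional_separates:
  assumes "vspace C" and "c \<noteq> 0"
  obtains \<phi> where "lin C ground \<phi>" and "\<phi> c \<noteq> 0"
proof -
  interpret vector_space_pair "scale C" "scale ground"
    using assms(1) vspace_ground by (simp add: vspace_def vector_space_pair_def)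
  have "vs1.independent {c}"
    using assms(2) by simp
  from linear_independent_extend[OF this, of "\<lambda>_. 1"] obtain \<phi>
    where "Vector_Spaces.linear (scale C) (scale ground) \<phi>" "\<phi> c = 1" by auto
  then show thesis using that by (simp add: lin_def)
qed

lemma lin_sum_list: "lin A B f \<Longrightarrow> f (\<Sum>x\<leftarrow>xs. g x) = (\<Sum>x\<leftarrow>xs. f (g x))"
proof (induction xs)
  case Nil
  then have "f (0 + 0) = f 0 + f 0" unfolding lin_iff by blast
  then show ?case by simp
qed (simp add: lin_iff)

lemma sum_list_fun_apply: "(\<Sum>x\<leftarrow>xs. g x) \<beta> = (\<Sum>x\<leftarrow>xs. g x \<beta>)"
  by (induction xs) auto

lemma bilin_functional:
  assumes "bilin A B C f" and "lin C D \<phi>"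
  shows "bilin A B D (\<lambda>a b. \<phi> (f a b))"
  using assms unfolding bilin_def lin_iff by auto

lemma sweedler_eq:
  assumes "bilin A B C f" and t: "t = (\<Sum>(a, b)\<leftarrow>ps. tens A B a b)"
  shows "sweedler A B t f = (\<Sum>(a, b)\<leftarrow>ps. f a b)"
proof -
  define qs where "qs = (SOME ps. t = (\<Sum>(a, b)\<leftarrow>ps. tens A B a b))"
  have q: "t = (\<Sum>(a, b)\<leftarrow>qs. tens A B a b)"
    unfolding qs_def by (rule someI[of _ ps]) (rule t)
  have C: "vspace C" using assms(1) by (auto simp: bilin_def lin_iff)
  have "(\<Sum>(a, b)\<leftarrow>qs. f a b) = (\<Sum>(a, b)\<leftarrow>ps. f a b)"
  proof (rule ccontr)
    assume "\<not> ?thesis"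
    then have "(\<Sum>(a, b)\<leftarrow>qs. f a b) - (\<Sum>(a, b)\<leftarrow>ps. f a b) \<noteq> 0" by simp
    from functional_separates[OF C this] obtain \<phi> where \<phi>: "lin C ground \<phi>"
      and ne: "\<phi> ((\<Sum>(a, b)\<leftarrow>qs. f a b) - (\<Sum>(a, b)\<leftarrow>ps. f a b)) \<noteq> 0" .
    have ev: "\<phi> (\<Sum>(a, b)\<leftarrow>rs. f a b) = t (\<lambda>a b. \<phi> (f a b))"
      if "t = (\<Sum>(a, b)\<leftarrow>rs. tens A B a b)" for rs
      unfolding that sum_list_fun_apply lin_sum_list[OF \<phi>]
      using bilin_functional[OF assms(1) \<phi>]
      by (intro arg_cong[where f = sum_list] map_cong) (auto simp: tens_def)
    have "\<phi> (x - y) + \<phi> y = \<phi> x" for x y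
      using \<phi> unfolding lin_iff by (metis diff_add_cancel)
    with ne ev[OF q] ev[OF t] show False by (metis add_cancel_left_left)
  qed
  then show ?thesis by (simp add: sweedler_def qs_def)
qed

lemma sweedler_tens: "bilin A B C f \<Longrightarrow> sweedler A B (tens A B a b) f = f a b"
  using sweedler_eq[of A B C f "tens A B a b" "[(a, b)]"] by simp

lemma bilin_tens:
  assumes "vspace A" and "vspace B"
  shows "bilin A B TT (tens A B)"
  using assms vspace_TT
  by (auto simp: bilin_def lin_iff tens_def TT_def ground_def fun_eq_iff)

lemma tspace_iff:
  assumes "vspace A" and "vspace B"
  shows "t \<in> tspace A B \<longleftrightarrow> (\<exists>ps. t = (\<Sum>(a, b)\<leftarrow>ps. tens A B a b))"
proof -
  interpret T: vector_space "scale (TT :: ('a, ('a, 'b, 'd) tensor) vect)"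
    using vspace_TT by (simp add: vspace_def)
  note bt = bilin_tens[OF assms]
  show ?thesis
  proof
    assume "t \<in> tspace A B"
    then have "t \<in> T.span {tens A B a b | a b. True}" by (simp add: tspace_def vspan_def)
    then show "\<exists>ps. t = (\<Sum>(a, b)\<leftarrow>ps. tens A B a b)"
    proof (induction rule: T.span_induct_alt)
      case base
      show ?case by (rule exI[of _ "[]"]) simp
    next
      case (step c x y)
      then obtain a b ps where x: "x = tens A B a b" and y: "y = (\<Sum>(a, b)\<leftarrow>ps. tens A B a b)"
        by auto
      have "scale TT c x = tens A B (scale A c a) b"
        using bt unfolding x bilin_def lin_iff by simp
      then show ?case using y by (intro exI[of _ "(scale A c a, b) # ps"]) simp
    qed
  next
    assume "\<exists>ps. t = (\<Sum>(a, b)\<leftarrow>ps. tens A B a b)"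
    then obtain ps where "t = (\<Sum>(a, b)\<leftarrow>ps. tens A B a b)" ..
    moreover have "(\<Sum>(a, b)\<leftarrow>ps. tens A B a b) \<in> T.span {tens A B a b | a b. True}"
    proof (induction ps)
      case Nil
      show ?case unfolding list.map sum_list.Nil by (rule T.span_zero)
    next
      case (Cons q ps)
      obtain a b where q: "q = (a, b)" by (cases q)
      have "tens A B a b \<in> T.span {tens A B a b | a b. True}" by (rule T.span_base) blast
      from T.span_add[OF this Cons.IH] show ?case unfolding q list.map sum_list.Cons prod.case .
    qed
    ultimately show "t \<in> tspace A B" by (simp add: tspace_def vspan_def)
  qed
qed


section \<open>Algebras, coalgebras and Hopf algebras\<close>

definition assoc_algebra :: "('k::field, 'a::ab_group_add, 'm) vect_scheme
    \<Rightarrow> ('a \<Rightarrow> 'a \<Rightarrow> 'a) \<Rightarrow> 'a \<Rightarrow> bool" where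
  "assoc_algebra A m u \<longleftrightarrow>
     vspace A \<and> bilin A A A m \<and>
     (\<forall>a b c. m (m a b) c = m a (m b c)) \<and>
     (\<forall>a. m u a = a \<and> m a u = a)"

definition alg_hom :: "('k::field, 'a::ab_group_add, 'm) vect_scheme \<Rightarrow> ('a \<Rightarrow> 'a \<Rightarrow> 'a) \<Rightarrow> 'a
    \<Rightarrow> ('k, 'b::ab_group_add, 'n) vect_scheme \<Rightarrow> ('b \<Rightarrow> 'b \<Rightarrow> 'b) \<Rightarrow> 'b
    \<Rightarrow> ('a \<Rightarrow> 'b) \<Rightarrow> bool" where
  "alg_hom A m u B m' u' f \<longleftrightarrow>
     lin A B f \<and> (\<forall>a b. f (m a b) = m' (f a) (f b)) \<and> f u = u'"

definition coalgebra :: "('k::field, 'a::ab_group_add, 'm) vect_scheme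
    \<Rightarrow> ('a \<Rightarrow> ('k, 'a, 'a) tensor) \<Rightarrow> ('a \<Rightarrow> 'k) \<Rightarrow> bool" where
  "coalgebra A D e \<longleftrightarrow>
     vspace A \<and> lin A TT D \<and> (\<forall>a. D a \<in> tspace A A) \<and> lin A ground e \<and>
     (\<forall>a. sweedler A A (D a) (\<lambda>x z. sweedler A A (D x) (\<lambda>u v. tens A TT u (tens A A v z)))
        = sweedler A A (D a) (\<lambda>x z. tens A TT x (D z))) \<and>
     (\<forall>a. sweedler A A (D a) (\<lambda>x y. scale A (e x) y) = a) \<and>
     (\<forall>a. sweedler A A (D a) (\<lambda>x y. scale A (e y) x) = a)"

record ('k, 'h) hopf = "('k, 'h) vect" +
  hmul :: "'h \<Rightarrow> 'h \<Rightarrow> 'h"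
  hone :: 'h
  hcomul :: "'h \<Rightarrow> ('k, 'h, 'h) tensor"
  hcounit :: "'h \<Rightarrow> 'k"
  hantip :: "'h \<Rightarrow> 'h"

definition hopf_algebra :: "('k::field, 'h::ab_group_add) hopf \<Rightarrow> bool" where
  "hopf_algebra H \<longleftrightarrow>
     assoc_algebra H (hmul H) (hone H) \<and>
     coalgebra H (hcomul H) (hcounit H) \<and>
     (\<forall>g h. hcomul H (hmul H g h) =
        sweedler H H (hcomul H g) (\<lambda>g1 g2. sweedler H H (hcomul H h) (\<lambda>h1 h2.
          tens H H (hmul H g1 h1) (hmul H g2 h2)))) \<and>
     hcomul H (hone H) = tens H H (hone H) (hone H) \<and>
     (\<forall>g h. hcounit H (hmul H g h) = hcounit H g * hcounit H h) \<and>
     hcounit H (hone H) = 1 \<and>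
     lin H H (hantip H) \<and>
     (\<forall>h. sweedler H H (hcomul H h) (\<lambda>h1 h2. hmul H (hantip H h1) h2)
            = scale H (hcounit H h) (hone H)) \<and>
     (\<forall>h. sweedler H H (hcomul H h) (\<lambda>h1 h2. hmul H h1 (hantip H h2))
            = scale H (hcounit H h) (hone H))"


section \<open>Modules and Yetter--Drinfeld modules\<close>

record ('k, 'h, 'a) hmod = "('k, 'a) vect" +
  act :: "'h \<Rightarrow> 'a \<Rightarrow> 'a"

record ('k, 'h, 'a) ydmod = "('k, 'h, 'a) hmod" +
  coact :: "'a \<Rightarrow> ('k, 'h, 'a) tensor"

definition h_module :: "('k::field, 'h::ab_group_add) hopf
    \<Rightarrow> ('k, 'h, 'a::ab_group_add, 'm) hmod_scheme \<Rightarrow> bool" where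
  "h_module H M \<longleftrightarrow>
     vspace M \<and> bilin H M M (act M) \<and>
     (\<forall>g h v. act M (hmul H g h) v = act M g (act M h v)) \<and>
     (\<forall>v. act M (hone H) v = v)"

definition h_linear :: "('k::field, 'h::ab_group_add, 'a::ab_group_add, 'm) hmod_scheme
    \<Rightarrow> ('k, 'h, 'b::ab_group_add, 'n) hmod_scheme \<Rightarrow> ('a \<Rightarrow> 'b) \<Rightarrow> bool" where
  "h_linear M N f \<longleftrightarrow> lin M N f \<and> (\<forall>h v. f (act M h v) = act N h (f v))"

definition h_comodule :: "('k::field, 'h::ab_group_add) hopf
    \<Rightarrow> ('k, 'h, 'a::ab_group_add, 'm) ydmod_scheme \<Rightarrow> bool" where
  "h_comodule H M \<longleftrightarrow>
     vspace M \<and> lin M TT (coact M) \<and> (\<forall>v. coact M v \<in> tspace H M) \<and>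
     (\<forall>v. sweedler H M (coact M v) (\<lambda>g w. sweedler H H (hcomul H g) (\<lambda>g1 g2.
             tens H TT g1 (tens H M g2 w)))
        = sweedler H M (coact M v) (\<lambda>g w. tens H TT g (coact M w))) \<and>
     (\<forall>v. sweedler H M (coact M v) (\<lambda>g w. scale M (hcounit H g) w) = v)"

definition yd_module :: "('k::field, 'h::ab_group_add) hopf
    \<Rightarrow> ('k, 'h, 'a::ab_group_add, 'm) ydmod_scheme \<Rightarrow> bool" where
  "yd_module H M \<longleftrightarrow>
     h_module H M \<and> h_comodule H M \<and>
     (\<forall>h v. coact M (act M h v) =
        sweedler H H (hcomul H h) (\<lambda>h1 h'. sweedler H H (hcomul H h') (\<lambda>h2 h3.
          sweedler H M (coact M v) (\<lambda>g w.
            tens H M (hmul H (hmul H h1 g) (hantip H h3)) (act M h2 w)))))"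

definition yd_morphism :: "('k::field, 'h::ab_group_add) hopf
    \<Rightarrow> ('k, 'h, 'a::ab_group_add, 'm) ydmod_scheme
    \<Rightarrow> ('k, 'h, 'b::ab_group_add, 'n) ydmod_scheme \<Rightarrow> ('a \<Rightarrow> 'b) \<Rightarrow> bool" where
  "yd_morphism H M N f \<longleftrightarrow>
     h_linear M N f \<and> (\<forall>v. coact N (f v) = tmap H M H N id f (coact M v))"

definition h_module_algebra :: "('k::field, 'h::ab_group_add) hopf
    \<Rightarrow> ('k, 'h, 'a::ab_group_add, 'm) hmod_scheme \<Rightarrow> ('a \<Rightarrow> 'a \<Rightarrow> 'a) \<Rightarrow> 'a \<Rightarrow> bool" where
  "h_module_algebra H A m u \<longleftrightarrow>
     h_module H A \<and> assoc_algebra A m u \<and>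
     (\<forall>h a b. act A h (m a b) =
        sweedler H H (hcomul H h) (\<lambda>h1 h2. m (act A h1 a) (act A h2 b))) \<and>
     (\<forall>h. act A h u = scale A (hcounit H h) u)"


section \<open>Graded braided Hopf algebras\<close>

record ('k, 'h, 'a) bhopf = "('k, 'h, 'a) ydmod" +
  bmul :: "'a \<Rightarrow> 'a \<Rightarrow> 'a"
  bone :: 'a
  bcomul :: "'a \<Rightarrow> ('k, 'a, 'a) tensor"
  bcounit :: "'a \<Rightarrow> 'k"
  bantip :: "'a \<Rightarrow> 'a"
  grade :: "nat \<Rightarrow> 'a set"

text \<open>
  The braided coproduct of \<open>a \<otimes> b\<close>:
  \<open>(a\<^sub>1 \<otimes> a\<^sub>2\<^sub>(\<^sub>-\<^sub>1\<^sub>) \<cdot> b\<^sub>1) \<otimes> (a\<^sub>2\<^sub>(\<^sub>0\<^sub>) \<otimes> b\<^sub>2)\<close>, evaluated on a function of the four tensor factors.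
\<close>

definition bsweedler :: "('k::field, 'h::ab_group_add) hopf
    \<Rightarrow> ('k, 'h, 'a::ab_group_add, 'm) bhopf_scheme \<Rightarrow> 'a \<Rightarrow> 'a
    \<Rightarrow> ('a \<Rightarrow> 'a \<Rightarrow> 'a \<Rightarrow> 'a \<Rightarrow> 'c::ab_group_add) \<Rightarrow> 'c" where
  "bsweedler H B a b F =
     sweedler B B (bcomul B a) (\<lambda>a1 a2. sweedler B B (bcomul B b) (\<lambda>b1 b2.
       sweedler H B (coact B a2) (\<lambda>g a20. F a1 (act B g b1) a20 b2)))"

definition braided_hopf :: "('k::field, 'h::ab_group_add) hopf
    \<Rightarrow> ('k, 'h, 'a::ab_group_add, 'm) bhopf_scheme \<Rightarrow> bool" where
  "braided_hopf H B \<longleftrightarrow>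
     yd_module H B \<and>
     h_module_algebra H B (bmul B) (bone B) \<and>
     (\<forall>a b. coact B (bmul B a b) =
        sweedler H B (coact B a) (\<lambda>g a0. sweedler H B (coact B b) (\<lambda>h b0.
          tens H B (hmul H g h) (bmul B a0 b0)))) \<and>
     coact B (bone B) = tens H B (hone H) (bone B) \<and>
     coalgebra B (bcomul B) (bcounit B) \<and>
     (\<forall>h a. bcomul B (act B h a) =
        sweedler H H (hcomul H h) (\<lambda>h1 h2. sweedler B B (bcomul B a) (\<lambda>a1 a2.
          tens B B (act B h1 a1) (act B h2 a2)))) \<and>
     (\<forall>h a. bcounit B (act B h a) = hcounit H h * bcounit B a) \<and>
     (\<forall>a. sweedler H B (coact B a) (\<lambda>g a0. tens H TT g (bcomul B a0)) =
        sweedler B B (bcomul B a) (\<lambda>a1 a2. sweedler H B (coact B a1) (\<lambda>g a10.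
          sweedler H B (coact B a2) (\<lambda>h a20. tens H TT (hmul H g h) (tens B B a10 a20))))) \<and>
     (\<forall>a. sweedler H B (coact B a) (\<lambda>g a0. scale H (bcounit B a0) g)
        = scale H (bcounit B a) (hone H)) \<and>
     (\<forall>a b. bcomul B (bmul B a b) =
        bsweedler H B a b (\<lambda>a1 b1 a2 b2. tens B B (bmul B a1 b1) (bmul B a2 b2))) \<and>
     bcomul B (bone B) = tens B B (bone B) (bone B) \<and>
     (\<forall>a b. bcounit B (bmul B a b) = bcounit B a * bcounit B b) \<and>
     bcounit B (bone B) = 1 \<and>
     yd_morphism H B B (bantip B) \<and>
     (\<forall>a. sweedler B B (bcomul B a) (\<lambda>a1 a2. bmul B (bantip B a1) a2)
            = scale B (bcounit B a) (bone B)) \<and>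
     (\<forall>a. sweedler B B (bcomul B a) (\<lambda>a1 a2. bmul B a1 (bantip B a2))
            = scale B (bcounit B a) (bone B))"

definition graded_braided_hopf :: "('k::field, 'h::ab_group_add) hopf
    \<Rightarrow> ('k, 'h, 'a::ab_group_add, 'm) bhopf_scheme \<Rightarrow> bool" where
  "graded_braided_hopf H B \<longleftrightarrow>
     braided_hopf H B \<and>
     (\<forall>n. is_subspace B (grade B n)) \<and>
     (\<forall>a. \<exists>!f. (\<forall>n. f n \<in> grade B n) \<and> finite {n. f n \<noteq> 0} \<and> a = (\<Sum>n | f n \<noteq> 0. f n)) \<and>
     (\<forall>n h. \<forall>a\<in>grade B n. act B h a \<in> grade B n) \<and>
     (\<forall>n. \<forall>a\<in>grade B n. coact B a \<in> vspan TT {tens H B g b | g b. b \<in> grade B n}) \<and>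
     (\<forall>i j. \<forall>a\<in>grade B i. \<forall>b\<in>grade B j. bmul B a b \<in> grade B (i + j)) \<and>
     bone B \<in> grade B 0 \<and>
     (\<forall>n. \<forall>a\<in>grade B n. bcomul B a \<in>
        vspan TT {tens B B b c | b c i j. i + j = n \<and> b \<in> grade B i \<and> c \<in> grade B j}) \<and>
     (\<forall>n>0. \<forall>a\<in>grade B n. bcounit B a = 0) \<and>
     (\<forall>n. \<forall>a\<in>grade B n. bantip B a \<in> grade B n)"

definition graded_bhopf_hom :: "('k::field, 'h::ab_group_add) hopf
    \<Rightarrow> ('k, 'h, 'a::ab_group_add, 'm) bhopf_scheme
    \<Rightarrow> ('k, 'h, 'b::ab_group_add, 'n) bhopf_scheme \<Rightarrow> ('a \<Rightarrow> 'b) \<Rightarrow> bool" where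
  "graded_bhopf_hom H A B f \<longleftrightarrow>
     yd_morphism H A B f \<and>
     alg_hom A (bmul A) (bone A) B (bmul B) (bone B) f \<and>
     (\<forall>a. bcomul B (f a) = tmap A A B B f f (bcomul A a)) \<and>
     (\<forall>a. bcounit B (f a) = bcounit A a) \<and>
     (\<forall>a. f (bantip A a) = bantip B (f a)) \<and>
     (\<forall>n. f ` grade A n \<subseteq> grade B n)"

definition primitives :: "('k::field, 'h::ab_group_add, 'a::ab_group_add, 'm) bhopf_scheme
    \<Rightarrow> 'a set" where
  "primitives B = {a. bcomul B a = tens B B a (bone B) + tens B B (bone B) a}"

definition generated_by :: "('k::field, 'h::ab_group_add, 'a::ab_group_add, 'm) bhopf_scheme
    \<Rightarrow> 'a set \<Rightarrow> bool" where
  "generated_by B X \<longleftrightarrow>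
     (\<forall>S. is_subspace B S \<and> bone B \<in> S \<and> (\<forall>a\<in>S. \<forall>b\<in>S. bmul B a b \<in> S) \<and> X \<subseteq> S
        \<longrightarrow> S = UNIV)"

text \<open>
  Nichols algebra of \<open>V\<close>: a connected graded Hopf algebra in Yetter--Drinfeld modules, with
  \<open>j\<close> identifying \<open>V\<close> with the degree one part, which generates it and consists of all
  primitive elements.
\<close>

definition nichols_algebra :: "('k::field, 'h::ab_group_add) hopf
    \<Rightarrow> ('k, 'h, 'v::ab_group_add, 'm) ydmod_scheme
    \<Rightarrow> ('k, 'h, 'b::ab_group_add, 'n) bhopf_scheme \<Rightarrow> ('v \<Rightarrow> 'b) \<Rightarrow> bool" where
  "nichols_algebra H V B j \<longleftrightarrow>
     graded_braided_hopf H B \<and>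
     grade B 0 = vspan B {bone B} \<and>
     yd_morphism H V B j \<and> inj j \<and> range j = grade B 1 \<and>
     primitives B = grade B 1 \<and>
     generated_by B (grade B 1)"

text \<open>
  Tensor algebra of \<open>V\<close>, for a basis \<open>x 1, \<dots>, x \<theta>\<close> of \<open>V\<close>: the words of length \<open>n\<close> in the
  basis form a basis of the degree \<open>n\<close> part \<open>V \<otimes> \<dots> \<otimes> V\<close>, and \<open>V\<close> is primitive.
\<close>

definition tensor_algebra :: "('k::field, 'h::ab_group_add) hopf
    \<Rightarrow> ('k, 'h, 'v::ab_group_add, 'm) ydmod_scheme \<Rightarrow> nat \<Rightarrow> (nat \<Rightarrow> 'v)
    \<Rightarrow> ('k, 'h, 't::ab_group_add, 'n) bhopf_scheme \<Rightarrow> ('v \<Rightarrow> 't) \<Rightarrow> bool" where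
  "tensor_algebra H V \<theta> x T j \<longleftrightarrow>
     graded_braided_hopf H T \<and>
     yd_morphism H V T j \<and> range j \<subseteq> primitives T \<and>
     (let word = (\<lambda>w. foldr (\<lambda>i. bmul T (j (x i))) w (bone T)) in
        family_basis T {w. set w \<subseteq> {1..\<theta>}} word \<and>
        (\<forall>n. grade T n = vspan T (word ` {w. set w \<subseteq> {1..\<theta>} \<and> length w = n})))"

definition pre_nichols :: "('k::field, 'h::ab_group_add) hopf
    \<Rightarrow> ('k, 'h, 't::ab_group_add, 'm) bhopf_scheme \<Rightarrow> ('v \<Rightarrow> 't)
    \<Rightarrow> ('k, 'h, 'b::ab_group_add, 'n) bhopf_scheme \<Rightarrow> ('v \<Rightarrow> 'b)
    \<Rightarrow> ('k, 'h, 'a::ab_group_add, 'o) bhopf_scheme \<Rightarrow> ('t \<Rightarrow> 'a) \<Rightarrow> ('a \<Rightarrow> 'b) \<Rightarrow> bool" where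
  "pre_nichols H T jT B jB A q \<pi> \<longleftrightarrow>
     graded_braided_hopf H A \<and>
     graded_bhopf_hom H T A q \<and> surj q \<and>
     graded_bhopf_hom H A B \<pi> \<and> surj \<pi> \<and>
     (\<forall>v. \<pi> (q (jT v)) = jB v)"

definition reduced_comul :: "('k::field, 'h::ab_group_add, 'a::ab_group_add, 'm) bhopf_scheme
    \<Rightarrow> ('a \<Rightarrow> ('k, 'a, 'a) tensor) \<Rightarrow> bool" where
  "reduced_comul A D \<longleftrightarrow>
     lin A TT D \<and>
     (\<forall>n>0. \<forall>a\<in>grade A n. D a = bcomul A a - tens A A a (bone A) - tens A A (bone A) a) \<and>
     (\<forall>a\<in>grade A 0. D a = 0)"


section \<open>Noncommutative polynomials\<close>

type_synonym 'k ncpoly = "nat list \<Rightarrow>\<^sub>0 'k"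

definition nc_homogeneous :: "nat \<Rightarrow> nat \<Rightarrow> 'k::field ncpoly \<Rightarrow> bool" where
  "nc_homogeneous \<theta> n p \<longleftrightarrow> (\<forall>w\<in>Poly_Mapping.keys p. set w \<subseteq> {1..\<theta>} \<and> length w = n)"

definition nc_eval :: "('k::field, 'a::ab_group_add, 'm) vect_scheme
    \<Rightarrow> ('a \<Rightarrow> 'a \<Rightarrow> 'a) \<Rightarrow> 'a \<Rightarrow> (nat \<Rightarrow> 'a) \<Rightarrow> 'k ncpoly \<Rightarrow> 'a" where
  "nc_eval A m u z p =
     (\<Sum>w\<in>Poly_Mapping.keys p. scale A (Poly_Mapping.lookup p w) (foldr (\<lambda>i. m (z i)) w u))"


section \<open>Cleft objects and cocycles\<close>

record ('k, 'h, 'e, 'b) comod_alg = "('k, 'h, 'e) hmod" +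
  cmul :: "'e \<Rightarrow> 'e \<Rightarrow> 'e"
  cone :: 'e
  rho :: "'e \<Rightarrow> ('k, 'e, 'b) tensor"

definition comodule_algebra :: "('k::field, 'h::ab_group_add) hopf
    \<Rightarrow> ('k, 'h, 'b::ab_group_add, 'm) bhopf_scheme
    \<Rightarrow> ('k, 'h, 'e::ab_group_add, 'b) comod_alg \<Rightarrow> bool" where
  "comodule_algebra H B E \<longleftrightarrow>
     h_module_algebra H E (cmul E) (cone E) \<and>
     lin E TT (rho E) \<and> (\<forall>e. rho E e \<in> tspace E B) \<and>
     (\<forall>e. sweedler E B (rho E e) (\<lambda>e' c. sweedler E B (rho E e') (\<lambda>e0 b.
             tens E TT e0 (tens B B b c)))
        = sweedler E B (rho E e) (\<lambda>e0 b. tens E TT e0 (bcomul B b))) \<and>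
     (\<forall>e. sweedler E B (rho E e) (\<lambda>e0 b. scale E (bcounit B b) e0) = e) \<and>
     (\<forall>h e. rho E (act E h e) =
        sweedler H H (hcomul H h) (\<lambda>h1 h2. sweedler E B (rho E e) (\<lambda>e0 b.
          tens E B (act E h1 e0) (act B h2 b)))) \<and>
     \<comment> \<open>the product of \<open>E \<otimes> B\<close> uses the braiding \<open>b \<otimes> e \<mapsto> b\<^sub>(\<^sub>-\<^sub>1\<^sub>) \<cdot> e \<otimes> b\<^sub>(\<^sub>0\<^sub>)\<close>\<close>
     (\<forall>d e. rho E (cmul E d e) =
        sweedler E B (rho E d) (\<lambda>d0 d1. sweedler E B (rho E e) (\<lambda>e0 e1.
          sweedler H B (coact B d1) (\<lambda>g d10.
            tens E B (cmul E d0 (act E g e0)) (bmul B d10 e1))))) \<and>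
     rho E (cone E) = tens E B (cone E) (bone B)"

definition coinvariants :: "('k::field, 'h::ab_group_add, 'b::ab_group_add, 'm) bhopf_scheme
    \<Rightarrow> ('k, 'h, 'e::ab_group_add, 'b) comod_alg \<Rightarrow> 'e set" where
  "coinvariants B E = {e. rho E e = tens E B e (bone B)}"

definition conv_invertible :: "('k::field, 'h::ab_group_add, 'b::ab_group_add, 'm) bhopf_scheme
    \<Rightarrow> ('k, 'h, 'e::ab_group_add, 'b) comod_alg \<Rightarrow> ('b \<Rightarrow> 'e) \<Rightarrow> bool" where
  "conv_invertible B E \<gamma> \<longleftrightarrow>
     (\<exists>\<gamma>'. lin B E \<gamma>' \<and>
        (\<forall>b. sweedler B B (bcomul B b) (\<lambda>b1 b2. cmul E (\<gamma> b1) (\<gamma>' b2))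
               = scale E (bcounit B b) (cone E)) \<and>
        (\<forall>b. sweedler B B (bcomul B b) (\<lambda>b1 b2. cmul E (\<gamma>' b1) (\<gamma> b2))
               = scale E (bcounit B b) (cone E)))"

definition cleft_object :: "('k::field, 'h::ab_group_add) hopf
    \<Rightarrow> ('k, 'h, 'b::ab_group_add, 'm) bhopf_scheme
    \<Rightarrow> ('k, 'h, 'e::ab_group_add, 'b) comod_alg \<Rightarrow> bool" where
  "cleft_object H B E \<longleftrightarrow>
     comodule_algebra H B E \<and>
     coinvariants B E = vspan E {cone E} \<and>
     (\<exists>\<gamma>. h_linear B E \<gamma> \<and> bij \<gamma> \<and>
          (\<forall>b. rho E (\<gamma> b) = tmap B B E B \<gamma> id (bcomul B b)) \<and>
          conv_invertible B E \<gamma>)"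

definition comod_alg_iso :: "('k::field, 'h::ab_group_add, 'b::ab_group_add, 'm) bhopf_scheme
    \<Rightarrow> ('k, 'h, 'e::ab_group_add, 'b) comod_alg
    \<Rightarrow> ('k, 'h, 'f::ab_group_add, 'b) comod_alg \<Rightarrow> bool" where
  "comod_alg_iso B E F \<longleftrightarrow>
     (\<exists>f. h_linear E F f \<and> bij f \<and>
          alg_hom E (cmul E) (cone E) F (cmul F) (cone F) f \<and>
          (\<forall>e. rho F (f e) = tmap E B F B f id (rho E e)))"

text \<open>Linear maps \<open>B \<otimes> B \<rightarrow> k\<close> are given as bilinear forms.\<close>

definition Z2 :: "('k::field, 'h::ab_group_add) hopf
    \<Rightarrow> ('k, 'h, 'b::ab_group_add, 'm) bhopf_scheme \<Rightarrow> ('b \<Rightarrow> 'b \<Rightarrow> 'k) set" where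
  "Z2 H B = {\<sigma>.
     bilin B B ground \<sigma> \<and>
     (\<exists>\<sigma>'. bilin B B ground \<sigma>' \<and>
        (\<forall>a b. bsweedler H B a b (\<lambda>a1 b1 a2 b2. \<sigma> a1 b1 * \<sigma>' a2 b2)
                 = bcounit B a * bcounit B b) \<and>
        (\<forall>a b. bsweedler H B a b (\<lambda>a1 b1 a2 b2. \<sigma>' a1 b1 * \<sigma> a2 b2)
                 = bcounit B a * bcounit B b)) \<and>
     (\<forall>h a b. sweedler H H (hcomul H h) (\<lambda>h1 h2. \<sigma> (act B h1 a) (act B h2 b))
                 = hcounit H h * \<sigma> a b) \<and>
     (\<forall>x. \<sigma> x (bone B) = bcounit B x \<and> \<sigma> (bone B) x = bcounit B x) \<and>
     (\<forall>x y z. bsweedler H B x y (\<lambda>x1 y1 x2 y2. \<sigma> x1 y1 * \<sigma> (bmul B x2 y2) z)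
            = bsweedler H B y z (\<lambda>y1 z1 y2 z2. \<sigma> y1 z1 * \<sigma> x (bmul B y2 z2)))}"

definition cocycle_twist :: "('k::field, 'h::ab_group_add) hopf
    \<Rightarrow> ('k, 'h, 'b::ab_group_add, 'm) bhopf_scheme \<Rightarrow> ('b \<Rightarrow> 'b \<Rightarrow> 'k)
    \<Rightarrow> ('k, 'h, 'b, 'b) comod_alg" where
  "cocycle_twist H B \<sigma> =
     \<lparr>scale = scale B, act = act B,
      cmul = (\<lambda>a b. bsweedler H B a b (\<lambda>a1 b1 a2 b2. scale B (\<sigma> a1 b1) (bmul B a2 b2))),
      cone = bone B, rho = bcomul B\<rparr>"

end

theory Submission
  imports Defs
begin

text \<open>
  Write \<open>D b = \<rho> (\<ell> b) - (\<ell> \<otimes> id) (\<Delta> b)\<close> for the failure of \<open>\<ell>\<close> to be colinear,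
  \<open>M = (\<epsilon>\<^sub>0 \<otimes> id) \<rho>\<close>, which is colinear, and \<open>n = M \<ell> - id\<close>, which is \<open>(\<epsilon>\<^sub>0 \<otimes> id) D\<close>. Since
  \<open>\<pi>\<^sub>E \<tau>\<^sub>2 = \<pi>\<^sub>E - \<ell> \<pi>\<^sub>B\<close> vanishes on \<open>\<iota> B\<close>, the tensor
  \<open>(\<pi>\<^sub>E \<tau>\<^sub>2 \<otimes> \<pi>\<^sub>B) \<Delta>\<close> of \<open>\<iota> b\<close>, reduced or not, is \<open>D b\<close>. Hence the two conditions
  say \<open>(\<ell> M \<otimes> id) D = D\<close> and \<open>D n = 0\<close>, and \<open>\<omega> = \<ell> (id - n)\<close>. The first gives
  \<open>D = (\<ell> \<otimes> id) (\<Delta> n - (n \<otimes> id) \<Delta>)\<close>; together with the second, \<open>\<omega>\<close> is colinear. Applying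
  \<open>\<epsilon>\<^sub>0 \<otimes> id\<close> to \<open>D n = 0\<close> gives \<open>n\<^sup>2 = 0\<close>, so \<open>\<omega>\<close> is bijective. It differs from a convolution
  invertible section by a convolution invertible form on \<open>B\<close>, so it is a section itself.

  For a section \<open>\<omega>\<close> with \<open>\<epsilon>\<^sub>0 \<omega> = \<epsilon>\<close>, colinearity turns \<open>\<omega> a \<cdot> \<omega> b\<close> into
  \<open>\<omega>\<close> of the product \<open>\<sigma> * m\<close>; the cocycle identity is \<open>\<epsilon>\<^sub>0\<close> of associativity in \<open>E\<close>.
  The form \<open>\<sigma>\<close>, read in the braided convolution algebra of maps \<open>B \<otimes> B \<rightarrow> E\<close>, is the quotient of
  \<open>m\<^sub>E (\<omega> \<otimes> \<omega>)\<close> by \<open>\<omega> m\<close>, both of which are invertible.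
\<close>

section \<open>Linear and multilinear maps\<close>

lemma lin_add: "lin A B f \<Longrightarrow> f (x + y) = f x + f y"
  and lin_scale: "lin A B f \<Longrightarrow> f (scale A c x) = scale B c (f x)"
  by (auto simp: lin_iff)

lemma lin_zero: "lin A B f \<Longrightarrow> f 0 = 0"
  using lin_add[of A B f 0 0] by simp

lemma lin_diff: "lin A B f \<Longrightarrow> f (x - y) = f x - f y"
  using lin_add[of A B f "x - y" y] by simp

lemma lin_compose: "lin A B f \<Longrightarrow> lin X A g \<Longrightarrow> lin X B (\<lambda>x. f (g x))"
  by (simp add: lin_iff)

lemma lin_ident: "vspace A \<Longrightarrow> lin A A (\<lambda>x. x)"
  by (simp add: lin_iff)

lemma lin_id: "vspace A \<Longrightarrow> lin A A id"
  by (simp add: lin_iff)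

lemma lin_inv:
  assumes "lin A B f" "bij f" shows "lin B A (inv f)"
  using assms by (auto simp: lin_iff) (metis bij_inv_eq_iff)+

lemma scale_scale: "vspace A \<Longrightarrow> scale A a (scale A b x) = scale A (a * b) x"
  and scale_one: "vspace A \<Longrightarrow> scale A 1 x = x"
  and scale_zero_right: "vspace A \<Longrightarrow> scale A a 0 = 0"
  and scale_zero_left: "vspace A \<Longrightarrow> scale A 0 x = 0"
  by (simp_all add: vspace_def vector_space.vector_space_assms module.scale_zero_left
    module.scale_zero_right module_iff_vector_space)

lemma scale_ground [simp]: "scale ground c x = c * x"
  by (simp add: ground_def)

lemma lin_const_zero: "vspace A \<Longrightarrow> vspace B \<Longrightarrow> lin A B (\<lambda>_. 0)"
  by (simp add: lin_iff scale_zero_right)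

lemma lin_scale_right:
  assumes "lin X A g" shows "lin X A (\<lambda>x. scale A c (g x))"
proof -
  interpret vector_space "scale A" using assms by (simp add: lin_iff vspace_def)
  show ?thesis using assms by (auto simp: lin_iff scale_right_distrib mult.commute)
qed

lemma lin_scale_left:
  assumes "vspace A" "lin X ground g" shows "lin X A (\<lambda>x. scale A (g x) a)"
proof -
  interpret vector_space "scale A" using assms(1) by (simp add: vspace_def)
  show ?thesis using assms by (auto simp: lin_iff scale_left_distrib)
qed

lemma lin_times_right: "lin X ground g \<Longrightarrow> lin X ground (\<lambda>x. c * g x)"
  using lin_scale_right[of X ground g c] by simp

lemma lin_times_left: "lin X ground g \<Longrightarrow> lin X ground (\<lambda>x. g x * c)"
  using lin_times_right[of X g c] by (simp add: mult.commute)

lemma lin_fun_diff: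
  assumes "lin X A f" "lin X A g" shows "lin X A (\<lambda>x. f x - g x)"
proof -
  interpret vector_space "scale A" using assms(1) by (simp add: lin_iff vspace_def)
  show ?thesis using assms by (auto simp: lin_iff scale_right_diff_distrib)
qed

lemma lin_eq_on_basis:
  assumes "is_basis A S" "lin A C f" "lin A C g" "\<And>b. b \<in> S \<Longrightarrow> f b = g b"
  shows "f x = g x"
proof -
  interpret vector_space_pair "scale A" "scale C"
    using assms(2) by (simp add: lin_iff vspace_def vector_space_pair_def)
  show ?thesis
    using linear_eq_on[of f g x S] assms by (simp add: lin_def is_basis_def vspan_def)
qed

lemma lin_nonzero_on_basis:
  assumes "is_basis A S" "lin A C f" "f x \<noteq> 0"
  obtains b where "b \<in> S" "f b \<noteq> 0"
  using lin_eq_on_basis[OF assms(1,2) lin_const_zero, of x] assms(2,3) by (auto simp: lin_iff)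

lemma lin_in_subspace_on_basis:
  assumes "is_basis A S" "lin A C f" "is_subspace C W" "\<And>b. b \<in> S \<Longrightarrow> f b \<in> W"
  shows "f x \<in> W"
proof -
  interpret vector_space_pair "scale A" "scale C"
    using assms(2) by (simp add: lin_iff vspace_def vector_space_pair_def)
  have lin: "Vector_Spaces.linear (scale A) (scale C) f" using assms(2) by (simp add: lin_def)
  have "f x \<in> f ` vs1.span S" using assms(1) by (simp add: is_basis_def vspan_def)
  also have "\<dots> = vs2.span (f ` S)" by (rule linear_span_image[OF lin, symmetric])
  also have "\<dots> \<subseteq> W" using assms(3,4) by (intro vs2.span_minimal) (auto simp: is_subspace_def)
  finally show ?thesis .
qed

lemma bij_on_family_basis:
  assumes "is_basis A S" "lin A C f" "family_basis C S f"
  shows "bij f"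
proof -
  interpret vector_space_pair "scale A" "scale C"
    using assms(2) by (simp add: lin_iff vspace_def vector_space_pair_def)
  have lin: "Vector_Spaces.linear (scale A) (scale C) f" using assms(2) by (simp add: lin_def)
  have "inj_on f (vs1.span S)"
    using linear_inj_on_span_iff_independent_image[OF lin, of S] assms(3)
    by (simp add: family_basis_def is_basis_def indep_def)
  moreover have "f ` vs1.span S = vs2.span (f ` S)"
    by (rule linear_span_image[OF lin, symmetric])
  ultimately show ?thesis
    using assms(1,3) by (auto simp: bij_def family_basis_def is_basis_def vspan_def)
qed

lemma family_basis_cong:
  assumes "\<And>i. i \<in> I \<Longrightarrow> v i = w i" shows "family_basis A I v \<longleftrightarrow> family_basis A I w"
  using assms by (simp add: family_basis_def cong: inj_on_cong image_cong)

lemma bilinI: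
  "(\<And>a. lin B C (f a)) \<Longrightarrow> (\<And>b. lin A C (\<lambda>a. f a b)) \<Longrightarrow> bilin A B C f"
  by (simp add: bilin_def)

lemma bilin_lin_right: "bilin A B C f \<Longrightarrow> lin X B g \<Longrightarrow> lin X C (\<lambda>x. f a (g x))"
  and bilin_lin_left: "bilin A B C f \<Longrightarrow> lin X A g' \<Longrightarrow> lin X C (\<lambda>x. f (g' x) b)"
  using lin_compose[of B C "f a" X g] lin_compose[of A C "\<lambda>a. f a b" X g']
  by (auto simp: bilin_def)

lemma bilin_vspace: "bilin A B C f \<Longrightarrow> vspace A" "bilin A B C f \<Longrightarrow> vspace B"
    "bilin A B C f \<Longrightarrow> vspace C"
  by (auto simp: bilin_def lin_iff)

lemma bilin_diff_left: "bilin A B C f \<Longrightarrow> f (a - a') b = f a b - f a' b"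
  using lin_diff[of A C "\<lambda>a. f a b"] by (simp add: bilin_def)

lemma bilin_zero_left: "bilin A B C f \<Longrightarrow> f 0 b = 0"
  using lin_zero[of A C "\<lambda>a. f a b"] by (simp add: bilin_def)

lemma bilin_scale: "bilin A B C f \<Longrightarrow> f (scale A c a) b = scale C c (f a b)"
    "bilin A B C f \<Longrightarrow> f a (scale B c b) = scale C c (f a b)"
  by (simp_all add: bilin_def lin_iff)

definition trilin :: "('k::field, 'a::ab_group_add, 'm) vect_scheme
    \<Rightarrow> ('k, 'b::ab_group_add, 'n) vect_scheme \<Rightarrow> ('k, 'c::ab_group_add, 'o) vect_scheme
    \<Rightarrow> ('k, 'd::ab_group_add, 'p) vect_scheme \<Rightarrow> ('a \<Rightarrow> 'b \<Rightarrow> 'c \<Rightarrow> 'd) \<Rightarrow> bool" where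
  "trilin A B C D F \<longleftrightarrow> (\<forall>a. bilin B C D (F a)) \<and> (\<forall>b c. lin A D (\<lambda>a. F a b c))"

lemma trilinI:
  "(\<And>a b. lin C D (F a b)) \<Longrightarrow> (\<And>a c. lin B D (\<lambda>b. F a b c)) \<Longrightarrow> (\<And>b c. lin A D (\<lambda>a. F a b c))
    \<Longrightarrow> trilin A B C D F"
  by (simp add: trilin_def bilin_def)

definition hexalin :: "('k::field, 'a::ab_group_add, 'm) vect_scheme
    \<Rightarrow> ('k, 'd::ab_group_add, 'n) vect_scheme \<Rightarrow> ('a \<Rightarrow> 'a \<Rightarrow> 'a \<Rightarrow> 'a \<Rightarrow> 'a \<Rightarrow> 'a \<Rightarrow> 'd) \<Rightarrow> bool" where
  "hexalin A D G \<longleftrightarrow> (\<forall>a b c. trilin A A A D (G a b c))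
     \<and> (\<forall>d e f. trilin A A A D (\<lambda>a b c. G a b c d e f))"

lemma hexalinI:
  "(\<And>a b c. trilin A A A D (G a b c)) \<Longrightarrow> (\<And>d e f. trilin A A A D (\<lambda>a b c. G a b c d e f))
    \<Longrightarrow> hexalin A D G"
  by (simp add: hexalin_def)

lemma hexalin_lin:
  assumes "hexalin A D G"
  shows "lin A D (\<lambda>a. G a b c d e f)" "lin A D (\<lambda>b. G a b c d e f)" "lin A D (\<lambda>c. G a b c d e f)"
    "lin A D (\<lambda>d. G a b c d e f)" "lin A D (\<lambda>e. G a b c d e f)" "lin A D (\<lambda>f. G a b c d e f)"
  using assms by (simp_all add: hexalin_def trilin_def bilin_def)

section \<open>Tensors and Sweedler sums\<close>

definition tensor_rep :: "('k::field, 'a::ab_group_add, 'm) vect_scheme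
    \<Rightarrow> ('k, 'b::ab_group_add, 'n) vect_scheme \<Rightarrow> ('k, 'a, 'b) tensor \<Rightarrow> ('a \<times> 'b) list" where
  "tensor_rep A B t = (SOME ps. t = (\<Sum>(a, b)\<leftarrow>ps. tens A B a b))"

lemma sweedler_rep: "sweedler A B t f = (\<Sum>(a, b)\<leftarrow>tensor_rep A B t. f a b)"
  by (simp add: sweedler_def tensor_rep_def Let_def)

lemma tspace_rep:
  assumes "vspace A" "vspace B" "t \<in> tspace A B"
  shows "t = (\<Sum>(a, b)\<leftarrow>tensor_rep A B t. tens A B a b)"
  unfolding tensor_rep_def by (rule someI_ex) (use assms in \<open>simp add: tspace_iff\<close>)

lemma sweedler_tens_ident:
  assumes "vspace A" "vspace B" "t \<in> tspace A B" shows "sweedler A B t (tens A B) = t"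
  unfolding sweedler_rep by (rule tspace_rep[OF assms, symmetric])

lemma sweedler_cong:
  "(\<And>a b. f a b = g a b) \<Longrightarrow> sweedler A B t f = sweedler A B t g"
  by presburger

lemma lin_sweedler: "lin C D \<phi> \<Longrightarrow> \<phi> (sweedler A B t f) = sweedler A B t (\<lambda>a b. \<phi> (f a b))"
  unfolding sweedler_rep by (subst lin_sum_list) (auto simp: case_prod_unfold)

lemma lin_bsweedler:
  "lin C D \<phi> \<Longrightarrow> \<phi> (bsweedler H B a b F) = bsweedler H B a b (\<lambda>a1 b1 a2 b2. \<phi> (F a1 b1 a2 b2))"
  by (simp add: bsweedler_def lin_sweedler)

lemma lin_sweedler_fun:
  assumes "\<And>a b. lin C D (\<lambda>c. f c a b)"
  shows "lin C D (\<lambda>c. sweedler A B t (f c))"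
proof -
  have CD: "vspace D" "vspace C" using assms by (auto simp: lin_iff)
  interpret vector_space "scale D" using CD by (simp add: vspace_def)
  have "lin C D (\<lambda>c. \<Sum>(a, b)\<leftarrow>ps. f c a b)" for ps
    using assms CD by (induction ps) (auto simp: lin_iff algebra_simps)
  then show ?thesis unfolding sweedler_rep .
qed

lemma sweedler_commute:
  "sweedler A B t (\<lambda>a b. sweedler C D s (f a b))
      = sweedler C D s (\<lambda>c d. sweedler A B t (\<lambda>a b. f a b c d))"
proof -
  have "(\<Sum>x\<leftarrow>ps. \<Sum>y\<leftarrow>qs. g x y) = (\<Sum>y\<leftarrow>qs. \<Sum>x\<leftarrow>ps. g x y)"
    for ps :: "'x list" and qs :: "'y list" and g :: "'x \<Rightarrow> 'y \<Rightarrow> 'z::comm_monoid_add"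
    by (induction ps) (auto simp: sum_list_addf)
  then show ?thesis by (simp add: sweedler_rep case_prod_unfold)
qed

lemma sweedler_fun_diff:
  "sweedler A B t (\<lambda>a b. f a b - g a b) = sweedler A B t f - sweedler A B t g"
  by (simp add: sweedler_rep case_prod_unfold sum_list_subtractf)

lemma is_subspace_tspace: "is_subspace TT (tspace A B)"
proof -
  interpret vector_space "scale TT" using vspace_TT by (simp add: vspace_def)
  show ?thesis by (simp add: is_subspace_def tspace_def vspan_def)
qed

lemma tspace_add: "s \<in> tspace A B \<Longrightarrow> t \<in> tspace A B \<Longrightarrow> s + t \<in> tspace A B"
  and tspace_zero: "0 \<in> tspace A B"
  and tspace_diff: "s \<in> tspace A B \<Longrightarrow> t \<in> tspace A B \<Longrightarrow> s - t \<in> tspace A B"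
proof -
  interpret vector_space "scale TT" using vspace_TT by (simp add: vspace_def)
  have "subspace (tspace A B)" using is_subspace_tspace by (simp add: is_subspace_def)
  then show "s \<in> tspace A B \<Longrightarrow> t \<in> tspace A B \<Longrightarrow> s + t \<in> tspace A B" "0 \<in> tspace A B"
    "s \<in> tspace A B \<Longrightarrow> t \<in> tspace A B \<Longrightarrow> s - t \<in> tspace A B"
    by (auto intro: subspace_add subspace_0 subspace_diff)
qed

lemma tens_in_tspace: "vspace A \<Longrightarrow> vspace B \<Longrightarrow> tens A B a b \<in> tspace A B"
  by (subst tspace_iff) (auto intro: exI[of _ "[(a, b)]"])

lemma sweedler_in_tspace:
  assumes "\<And>c d. G c d \<in> tspace A B" shows "sweedler C D t G \<in> tspace A B"
proof -
  have "(\<Sum>(c, d)\<leftarrow>ps. G c d) \<in> tspace A B" for ps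
    using assms by (induction ps) (auto intro: tspace_add tspace_zero simp: case_prod_unfold)
  then show ?thesis by (simp add: sweedler_rep)
qed

lemma sweedler_tensor_add:
  assumes F: "bilin A B C F" and s: "s \<in> tspace A B" and t: "t \<in> tspace A B"
  shows "sweedler A B (s + t) F = sweedler A B s F + sweedler A B t F"
proof -
  have "s + t = (\<Sum>(a, b)\<leftarrow>tensor_rep A B s @ tensor_rep A B t. tens A B a b)"
    unfolding map_append sum_list_append
    by (intro arg_cong2[where f = plus] tspace_rep bilin_vspace[OF F] s t)
  from sweedler_eq[OF F this] show ?thesis by (simp add: sweedler_rep)
qed

lemma sweedler_tensor_scale:
  assumes F: "bilin A B C F" and t: "t \<in> tspace A B"
  shows "sweedler A B (scale TT c t) F = scale C c (sweedler A B t F)"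
proof -
  let ?ps = "map (\<lambda>(a, b). (scale A c a, b)) (tensor_rep A B t)"
  have scale_sum: "scale Y c (\<Sum>(a, b)\<leftarrow>tensor_rep A B t. G a b) = (\<Sum>(a, b)\<leftarrow>?ps. G a b)"
    if "bilin A B Y G" for Y :: "('a, 'y::ab_group_add, 'z) vect_scheme" and G
    using lin_sum_list[OF lin_scale_right[OF lin_ident[OF bilin_vspace(3)[OF that]]], of c]
    by (simp add: case_prod_unfold comp_def bilin_scale(1)[OF that])
  have "scale TT c t = (\<Sum>(a, b)\<leftarrow>?ps. tens A B a b)"
    using tspace_rep[OF bilin_vspace(1,2)[OF F] t] scale_sum[OF bilin_tens] bilin_vspace[OF F]
    by metis
  from sweedler_eq[OF F this] show ?thesis by (simp add: sweedler_rep scale_sum[OF F])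
qed

text \<open>
  A tensor outside \<open>tspace\<close> has no Sweedler representation; composing with a linear projection
  onto \<open>tspace\<close> makes the induced map linear on all of \<open>TT\<close>.
\<close>

lemma tspace_projection:
  obtains pr :: "('k::field, 'a::ab_group_add, 'b::ab_group_add) tensor \<Rightarrow> ('k, 'a, 'b) tensor"
  where "lin TT TT pr" "\<And>t. pr t \<in> tspace A B" "\<And>t. t \<in> tspace A B \<Longrightarrow> pr t = t"
proof -
  interpret vector_space_pair "scale (TT :: ('k, ('k, 'a, 'b) tensor) vect)"
      "scale (TT :: ('k, ('k, 'a, 'b) tensor) vect)"
    using vspace_TT by (simp add: vspace_def vector_space_pair_def)
  have "Vector_Spaces.linear (scale TT) (scale TT) (\<lambda>x::('k, 'a, 'b) tensor. x)"
    using lin_ident[OF vspace_TT] by (simp add: lin_def)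
  from linear_exists_left_inverse_on[OF this, of "tspace A B"] is_subspace_tspace[of A B]
  obtain g where "range g \<subseteq> tspace A B" "Vector_Spaces.linear (scale TT) (scale TT) g"
    "\<forall>v\<in>tspace A B. g v = v" by (auto simp: is_subspace_def)
  then show thesis by (intro that[of g]) (auto simp: lin_def)
qed

lemma bilin_tensor_lift:
  assumes F: "bilin A B X F"
  obtains \<Phi> where "lin TT X \<Phi>" "\<And>t. t \<in> tspace A B \<Longrightarrow> \<Phi> t = sweedler A B t F"
proof -
  obtain pr where pr: "lin TT TT pr" "\<And>t. pr t \<in> tspace A B" "\<And>t. t \<in> tspace A B \<Longrightarrow> pr t = t"
    using tspace_projection[of A B] by metis
  have "lin TT X (\<lambda>t. sweedler A B (pr t) F)"
    by (simp add: lin_iff vspace_TT bilin_vspace[OF F] lin_add[OF pr(1)] lin_scale[OF pr(1)]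
        sweedler_tensor_add[OF F] sweedler_tensor_scale[OF F] pr(2))
  then show thesis by (rule that) (simp add: pr(3))
qed

lemma sweedler_tensor_zero: "bilin A B X F \<Longrightarrow> sweedler A B 0 F = 0"
  using sweedler_eq[of A B X F 0 "[]"] by simp

lemma sweedler_tensor_diff:
  assumes F: "bilin A B X F" and st: "s \<in> tspace A B" "t \<in> tspace A B"
  shows "sweedler A B (s - t) F = sweedler A B s F - sweedler A B t F"
  using sweedler_tensor_add[OF F tspace_diff[OF st] st(2)] by simp

lemma lin_sweedler_tensor:
  assumes "lin Y TT D" "\<And>y. D y \<in> tspace A B" "bilin A B X F"
  shows "lin Y X (\<lambda>y. sweedler A B (D y) F)"
proof -
  obtain \<Phi> where \<Phi>: "lin TT X \<Phi>" "\<And>t. t \<in> tspace A B \<Longrightarrow> \<Phi> t = sweedler A B t F"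
    using bilin_tensor_lift[OF assms(3)] by blast
  show ?thesis using lin_compose[OF \<Phi>(1) assms(1)] by (simp add: \<Phi>(2) assms(2))
qed

lemma sweedler_bind:
  assumes "bilin A B X F" and G: "\<And>c d. G c d \<in> tspace A B"
  shows "sweedler A B (sweedler C D t G) F = sweedler C D t (\<lambda>c d. sweedler A B (G c d) F)"
proof -
  obtain \<Phi> where \<Phi>: "lin TT X \<Phi>" "\<And>t. t \<in> tspace A B \<Longrightarrow> \<Phi> t = sweedler A B t F"
    using bilin_tensor_lift[OF assms(1)] by blast
  show ?thesis using lin_sweedler[OF \<Phi>(1), of C D t G] by (simp add: \<Phi>(2) G sweedler_in_tspace)
qed

lemma trilin_tensor_lift:
  assumes F: "trilin A B C X F"
  obtains \<Phi> where "lin TT X \<Phi>"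
    "\<And>a t. t \<in> tspace B C \<Longrightarrow> \<Phi> (tens A TT a t) = sweedler B C t (F a)"
proof -
  have Fa: "vspace A" "bilin B C X (F a)" "lin A X (\<lambda>a. F a b c)" for a b c
    using F by (auto simp: trilin_def lin_iff)
  obtain pr where pr: "lin TT TT pr" "\<And>t. pr t \<in> tspace B C" "\<And>t. t \<in> tspace B C \<Longrightarrow> pr t = t"
    using tspace_projection[of B C] by metis
  have K: "bilin A TT X (\<lambda>a t. sweedler B C (pr t) (F a))"
    by (intro bilinI lin_sweedler_tensor pr Fa lin_sweedler_fun)
  obtain \<Phi> where \<Phi>: "lin TT X \<Phi>"
    "\<And>s. s \<in> tspace A TT \<Longrightarrow> \<Phi> s = sweedler A TT s (\<lambda>a t. sweedler B C (pr t) (F a))"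
    using bilin_tensor_lift[OF K] by blast
  show thesis
  proof (rule that[OF \<Phi>(1)])
    fix a t assume "t \<in> tspace B C"
    then show "\<Phi> (tens A TT a t) = sweedler B C t (F a)"
      by (simp add: \<Phi>(2) tens_in_tspace bilin_vspace[OF K] sweedler_tens[OF K] pr(3))
  qed
qed

lemma tmap_in_tspace: "vspace C \<Longrightarrow> vspace D \<Longrightarrow> tmap A B C D f g t \<in> tspace C D"
  unfolding tmap_def by (intro sweedler_in_tspace tens_in_tspace)

lemma sweedler_tmap:
  assumes "bilin C D X F"
  shows "sweedler C D (tmap A B C D f g t) F = sweedler A B t (\<lambda>a b. F (f a) (g b))"
  using bilin_vspace[OF assms]
  by (simp add: tmap_def sweedler_bind[OF assms] tens_in_tspace sweedler_tens[OF assms])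

lemma bilin_tens_compose:
  assumes "lin A C f" "lin B D g" shows "bilin A B TT (\<lambda>a b. tens C D (f a) (g b))"
proof -
  have CD: "bilin C D TT (tens C D)" using assms by (simp add: bilin_tens lin_iff)
  show ?thesis by (intro bilinI bilin_lin_left[OF CD] bilin_lin_right[OF CD] assms)
qed

lemma tmap_tmap:
  assumes "lin C E f'" "lin D F g'"
  shows "tmap C D E F f' g' (tmap A B C D f g t) = tmap A B E F (\<lambda>a. f' (f a)) (\<lambda>b. g' (g b)) t"
  unfolding tmap_def[of C D] sweedler_tmap[OF bilin_tens_compose[OF assms]] by (simp add: tmap_def)

lemma tmap_id_tmap:
  assumes "lin C E f'" "vspace D"
  shows "tmap C D E D f' id (tmap A B C D f g t) = tmap A B E D (\<lambda>a. f' (f a)) g t"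
  using tmap_tmap[OF assms(1) lin_id[OF assms(2)]] by simp

lemma tmap_fun_diff:
  assumes "vspace C" "vspace D"
  shows "tmap A B C D (\<lambda>a. f a - f' a) g t = tmap A B C D f g t - tmap A B C D f' g t"
  by (simp add: tmap_def bilin_diff_left[OF bilin_tens[OF assms]] sweedler_fun_diff)

lemma lin_tmap:
  assumes "lin X TT t" "\<And>x. t x \<in> tspace A B" "lin A C f" "lin B D g"
  shows "lin X TT (\<lambda>x. tmap A B C D f g (t x))"
  unfolding tmap_def by (intro lin_sweedler_tensor assms bilin_tens_compose)

section \<open>Convolution algebras\<close>

lemma coalgebra_counit_left:
  assumes "coalgebra C \<Delta> \<epsilon>" "lin C X F"
  shows "sweedler C C (\<Delta> c) (\<lambda>x y. scale X (\<epsilon> x) (F y)) = F c"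
proof -
  have "F (sweedler C C (\<Delta> c) (\<lambda>x y. scale C (\<epsilon> x) y)) = F c"
    using assms(1) by (simp add: coalgebra_def)
  then show ?thesis by (simp add: lin_sweedler[OF assms(2)] lin_scale[OF assms(2)])
qed

lemma coalgebra_counit_right:
  assumes "coalgebra C \<Delta> \<epsilon>" "lin C X F"
  shows "sweedler C C (\<Delta> c) (\<lambda>x y. scale X (\<epsilon> y) (F x)) = F c"
proof -
  have "F (sweedler C C (\<Delta> c) (\<lambda>x y. scale C (\<epsilon> y) x)) = F c"
    using assms(1) by (simp add: coalgebra_def)
  then show ?thesis by (simp add: lin_sweedler[OF assms(2)] lin_scale[OF assms(2)])
qed

lemma coalgebra_coassoc:
  assumes "coalgebra C \<Delta> \<epsilon>" "trilin C C C X F"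
  shows "sweedler C C (\<Delta> c) (\<lambda>x z. sweedler C C (\<Delta> x) (\<lambda>u v. F u v z))
       = sweedler C C (\<Delta> c) (\<lambda>x z. sweedler C C (\<Delta> z) (F x))"
proof -
  obtain \<Phi> where \<Phi>: "lin TT X \<Phi>"
    "\<And>a t. t \<in> tspace C C \<Longrightarrow> \<Phi> (tens C TT a t) = sweedler C C t (F a)"
    using trilin_tensor_lift[OF assms(2)] by blast
  have "sweedler C C (\<Delta> c) (\<lambda>x z. sweedler C C (\<Delta> x) (\<lambda>u v. tens C TT u (tens C C v z)))
      = sweedler C C (\<Delta> c) (\<lambda>x z. tens C TT x (\<Delta> z))"
    and C: "vspace C" "\<And>c. \<Delta> c \<in> tspace C C" and F: "\<And>a. bilin C C X (F a)"
    using assms by (auto simp: coalgebra_def trilin_def)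
  from arg_cong[OF this(1), of \<Phi>] show ?thesis
    by (simp add: lin_sweedler[OF \<Phi>(1)] \<Phi>(2) tens_in_tspace sweedler_tens[OF F] C)
qed

named_theorems lin_intros

lemmas [lin_intros] = bilinI trilinI hexalinI lin_ident lin_scale_right lin_scale_left
  lin_times_left lin_times_right lin_fun_diff lin_sweedler_fun vspace_TT vspace_ground

locale convolution_algebra =
  fixes C :: "('k::field, 'c::ab_group_add, 'm) vect_scheme"
    and \<Delta> :: "'c \<Rightarrow> ('k, 'c, 'c) tensor" and \<epsilon> :: "'c \<Rightarrow> 'k"
    and A :: "('k, 'a::ab_group_add, 'n) vect_scheme"
    and mul :: "'a \<Rightarrow> 'a \<Rightarrow> 'a" and one :: 'a
  assumes coalgebra: "coalgebra C \<Delta> \<epsilon>" and algebra: "assoc_algebra A mul one"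
begin

abbreviation sweedler_comul where "sweedler_comul c \<equiv> sweedler C C (\<Delta> c)"

lemma vspace_conv [lin_intros]: "vspace C" "vspace A"
  and lin_comul: "lin C TT \<Delta>" and comul_tspace: "\<Delta> c \<in> tspace C C" and lin_counit: "lin C ground \<epsilon>"
  and bilin_mul: "bilin A A A mul"
  and mul_assoc: "mul (mul a b) d = mul a (mul b d)" and mul_one: "mul one a = a" "mul a one = a"
  using coalgebra algebra by (auto simp: coalgebra_def assoc_algebra_def)

lemmas lin_mul_conv [lin_intros] =
  lin_sweedler_tensor[OF lin_compose[OF lin_comul] comul_tspace] lin_compose[OF lin_counit]
  bilin_lin_left[OF bilin_mul] bilin_lin_right[OF bilin_mul]

lemmas mul_scale = bilin_scale[OF bilin_mul]

lemma mul_sweedler: "mul (sweedler X Y t F) a = sweedler X Y t (\<lambda>x y. mul (F x y) a)"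
    "mul a (sweedler X Y t F) = sweedler X Y t (\<lambda>x y. mul a (F x y))"
  using lin_sweedler[of A A "\<lambda>d. mul d a"] lin_sweedler[of A A "mul a"] bilin_mul
  by (auto simp: bilin_def)

definition conv :: "('c \<Rightarrow> 'a) \<Rightarrow> ('c \<Rightarrow> 'a) \<Rightarrow> 'c \<Rightarrow> 'a" where
  "conv f g c = sweedler_comul c (\<lambda>x y. mul (f x) (g y))"

definition scalar_map :: "('c \<Rightarrow> 'k) \<Rightarrow> 'c \<Rightarrow> 'a" where
  "scalar_map \<phi> c = scale A (\<phi> c) one"

lemma lin_conv:
  assumes "lin C A f" "lin C A g" shows "lin C A (conv f g)"
  unfolding conv_def[abs_def] by (intro lin_intros assms[THEN lin_compose])

lemma lin_scalar_map: "lin C ground \<phi> \<Longrightarrow> lin C A (scalar_map \<phi>)"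
  unfolding scalar_map_def[abs_def] by (intro lin_intros)

lemma conv_assoc:
  assumes "lin C A f" "lin C A g" "lin C A h"
  shows "conv (conv f g) h = conv f (conv g h)"
proof
  fix c
  have "conv (conv f g) h c
      = sweedler_comul c (\<lambda>x z. sweedler_comul x (\<lambda>u v. mul (f u) (mul (g v) (h z))))"
    by (simp only: conv_def mul_sweedler mul_assoc)
  also have "\<dots> = sweedler_comul c (\<lambda>x z. sweedler_comul z (\<lambda>u v. mul (f x) (mul (g u) (h v))))"
    by (rule coalgebra_coassoc[OF coalgebra, where X = A])
      (intro lin_intros assms[THEN lin_compose])
  also have "\<dots> = conv f (conv g h) c"
    by (simp only: conv_def mul_sweedler)
  finally show "conv (conv f g) h c = conv f (conv g h) c" .
qed

lemma conv_scalar_map_left: "conv (scalar_map \<phi>) g c = sweedler_comul c (\<lambda>x y. scale A (\<phi> x) (g y))"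
  by (simp add: conv_def scalar_map_def mul_scale mul_one)

lemma conv_unit_left:
  assumes "lin C A f" shows "conv (scalar_map \<epsilon>) f = f"
  by (rule ext) (simp add: conv_scalar_map_left coalgebra_counit_left[OF coalgebra assms])

lemma conv_scalar_maps:
  assumes "lin C ground \<phi>" "lin C ground \<psi>"
  shows "conv (scalar_map \<phi>) (scalar_map \<psi>)
    = scalar_map (\<lambda>c. sweedler_comul c (\<lambda>x y. \<phi> x * \<psi> y))"
proof
  fix c
  have "lin ground A (\<lambda>r. scale A r one)" by (intro lin_intros)
  from lin_sweedler[OF this, of C C "\<Delta> c"] show "conv (scalar_map \<phi>) (scalar_map \<psi>) c
      = scalar_map (\<lambda>c. sweedler_comul c (\<lambda>x y. \<phi> x * \<psi> y)) c"
    by (simp add: conv_scalar_map_left scalar_map_def scale_scale[OF vspace_conv(2)])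
qed

end

section \<open>Braided Hopf algebras\<close>

locale braided_hopf_algebra =
  fixes H :: "('k::field, 'h::ab_group_add) hopf"
    and B :: "('k, 'h, 'b::ab_group_add) bhopf"
  assumes hopf: "hopf_algebra H" and braided: "braided_hopf H B"
begin

abbreviation SH where "SH h \<equiv> sweedler H H (hcomul H h)"
abbreviation SB where "SB b \<equiv> sweedler B B (bcomul B b)"
abbreviation SC where "SC b \<equiv> sweedler H B (coact B b)"

lemma vspace_H [lin_intros, simp]: "vspace H"
  and vspace_B [lin_intros, simp]: "vspace B"
  and coalgebra_B: "coalgebra B (bcomul B) (bcounit B)"
  and bilin_hmul: "bilin H H H (hmul H)"
  and bilin_act: "bilin H B B (act B)"
  and bilin_bmul: "bilin B B B (bmul B)"
  and lin_hcounit: "lin H ground (hcounit H)"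
  and lin_bcounit: "lin B ground (bcounit B)"
  and lin_hcomul: "lin H TT (hcomul H)" and hcomul_tspace: "hcomul H h \<in> tspace H H"
  and lin_bcomul: "lin B TT (bcomul B)" and bcomul_tspace: "bcomul B b \<in> tspace B B"
  and lin_coact: "lin B TT (coact B)" and coact_tspace: "coact B b \<in> tspace H B"
  using hopf braided
  by (auto simp: hopf_algebra_def braided_hopf_def assoc_algebra_def coalgebra_def yd_module_def
    h_module_def h_comodule_def h_module_algebra_def)

lemmas lin_sweedlers [lin_intros] =
  lin_sweedler_tensor[OF lin_compose[OF lin_hcomul] hcomul_tspace]
  lin_sweedler_tensor[OF lin_compose[OF lin_bcomul] bcomul_tspace]
  lin_sweedler_tensor[OF lin_compose[OF lin_coact] coact_tspace]

lemmas lin_ops [lin_intros] =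
  bilin_lin_left[OF bilin_hmul] bilin_lin_right[OF bilin_hmul]
  bilin_lin_left[OF bilin_act] bilin_lin_right[OF bilin_act]
  bilin_lin_left[OF bilin_bmul] bilin_lin_right[OF bilin_bmul]
  bilin_lin_left[OF bilin_tens] bilin_lin_right[OF bilin_tens]
  lin_compose[OF lin_hcounit] lin_compose[OF lin_bcounit]
  lin_compose[OF lin_hcomul] lin_compose[OF lin_bcomul] lin_compose[OF lin_coact]

lemma act_one: "act B (hone H) b = b"
  and act_hmul: "act B (hmul H g h) b = act B g (act B h b)"
  and bcounit_act: "bcounit B (act B h b) = hcounit H h * bcounit B b"
  and bcounit_bmul: "bcounit B (bmul B a b) = bcounit B a * bcounit B b"
  and bcounit_bone: "bcounit B (bone B) = 1"
  using braided by (auto simp: braided_hopf_def yd_module_def h_module_def)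

lemmas bcounit_left = coalgebra_counit_left[OF coalgebra_B]
  and bcounit_right = coalgebra_counit_right[OF coalgebra_B]
  and coassoc = coalgebra_coassoc[OF coalgebra_B]

lemma hcounit_coact:
  assumes "lin B D F" shows "SC a (\<lambda>g w. scale D (hcounit H g) (F w)) = F a"
proof -
  have "F (SC a (\<lambda>g w. scale B (hcounit H g) w)) = F a"
    using braided by (simp add: braided_hopf_def yd_module_def h_comodule_def)
  then show ?thesis by (simp add: lin_sweedler[OF assms] lin_scale[OF assms])
qed

lemma bcounit_coact:
  assumes "lin H D F"
  shows "SC a (\<lambda>g w. scale D (bcounit B w) (F g)) = scale D (bcounit B a) (F (hone H))"
proof -
  have "F (SC a (\<lambda>g w. scale H (bcounit B w) g)) = F (scale H (bcounit B a) (hone H))"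
    using braided by (simp add: braided_hopf_def)
  then show ?thesis by (simp add: lin_sweedler[OF assms] lin_scale[OF assms])
qed

lemma coact_coassoc:
  assumes "trilin H H B D F"
  shows "SC a (\<lambda>g w. SH g (\<lambda>g1 g2. F g1 g2 w)) = SC a (\<lambda>g w. SC w (F g))"
proof -
  obtain \<Phi> where \<Phi>: "lin TT D \<Phi>"
    "\<And>g t. t \<in> tspace H B \<Longrightarrow> \<Phi> (tens H TT g t) = sweedler H B t (F g)"
    using trilin_tensor_lift[OF assms] by blast
  have F: "bilin H B D (F g)" for g using assms by (simp add: trilin_def)
  have "SC a (\<lambda>g w. SH g (\<lambda>g1 g2. tens H TT g1 (tens H B g2 w)))
      = SC a (\<lambda>g w. tens H TT g (coact B w))"
    using braided by (simp add: braided_hopf_def yd_module_def h_comodule_def)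
  from arg_cong[OF this, of \<Phi>] show ?thesis
    by (simp add: lin_sweedler[OF \<Phi>(1)] \<Phi>(2) tens_in_tspace sweedler_tens[OF F] coact_tspace)
qed

lemma coact_bcomul:
  assumes "trilin H B B D F"
  shows "SC a (\<lambda>g w. SB w (F g)) = SB a (\<lambda>x y. SC x (\<lambda>g u. SC y (\<lambda>h v. F (hmul H g h) u v)))"
proof -
  obtain \<Phi> where \<Phi>: "lin TT D \<Phi>"
    "\<And>g t. t \<in> tspace B B \<Longrightarrow> \<Phi> (tens H TT g t) = sweedler B B t (F g)"
    using trilin_tensor_lift[OF assms] by blast
  have F: "bilin B B D (F g)" for g using assms by (simp add: trilin_def)
  have "SC a (\<lambda>g w. tens H TT g (bcomul B w)) =
        SB a (\<lambda>x y. SC x (\<lambda>g u. SC y (\<lambda>h v. tens H TT (hmul H g h) (tens B B u v))))"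
    using braided by (simp add: braided_hopf_def)
  from arg_cong[OF this, of \<Phi>] show ?thesis
    by (simp add: lin_sweedler[OF \<Phi>(1)] \<Phi>(2) tens_in_tspace sweedler_tens[OF F] bcomul_tspace)
qed

lemma bcomul_act:
  assumes "bilin B B D F"
  shows "SB (act B h a) F = SH h (\<lambda>h1 h2. SB a (\<lambda>x y. F (act B h1 x) (act B h2 y)))"
proof -
  have "bcomul B (act B h a) = SH h (\<lambda>h1 h2. SB a (\<lambda>x y. tens B B (act B h1 x) (act B h2 y)))"
    using braided by (simp add: braided_hopf_def)
  then show ?thesis
    by (simp add: sweedler_bind[OF assms] sweedler_in_tspace tens_in_tspace sweedler_tens[OF assms])
qed

lemma bcomul_bmul:
  assumes "bilin B B D F"
  shows "SB (bmul B a b) F = bsweedler H B a b (\<lambda>a1 b1 a2 b2. F (bmul B a1 b1) (bmul B a2 b2))"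
proof -
  have "bcomul B (bmul B a b)
      = bsweedler H B a b (\<lambda>a1 b1 a2 b2. tens B B (bmul B a1 b1) (bmul B a2 b2))"
    using braided by (simp add: braided_hopf_def)
  then show ?thesis
    by (simp add: bsweedler_def sweedler_bind[OF assms] sweedler_in_tspace tens_in_tspace
        sweedler_tens[OF assms])
qed

definition bsweedler3 ::
    "'b \<Rightarrow> 'b \<Rightarrow> ('b \<Rightarrow> 'b \<Rightarrow> 'b \<Rightarrow> 'b \<Rightarrow> 'b \<Rightarrow> 'b \<Rightarrow> 'd::ab_group_add) \<Rightarrow> 'd" where
  "bsweedler3 a b G = SB a (\<lambda>a1 a'. SB a' (\<lambda>a2 a3. SB b (\<lambda>b1 b'. SB b' (\<lambda>b2 b3.
     SC a2 (\<lambda>h a20. SC a3 (\<lambda>g a3'. SC a3' (\<lambda>g' a30.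
       G a1 (act B h (act B g b1)) a20 (act B g' b2) a30 b3)))))))"

lemma bsweedler_left_nested:
  assumes "hexalin B D G"
  shows "bsweedler H B a b (\<lambda>a1 b1 a2 b2. bsweedler H B a1 b1 (\<lambda>u v w z. G u v w z a2 b2))
       = bsweedler3 a b G"
proof -
  note G = hexalin_lin[OF assms, THEN lin_compose]
  have "bsweedler H B a b (\<lambda>a1 b1 a2 b2. bsweedler H B a1 b1 (\<lambda>u v w z. G u v w z a2 b2))
     = SB a (\<lambda>a1 a2. SB b (\<lambda>b1 b2. SC a2 (\<lambda>g a20. SB a1 (\<lambda>a11 a12. SH g (\<lambda>g1 g2.
        SB b1 (\<lambda>b11 b12. SC a12 (\<lambda>h a120.
          G a11 (act B h (act B g1 b11)) a120 (act B g2 b12) a20 b2)))))))"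
    unfolding bsweedler_def by (intro sweedler_cong bcomul_act[where D = D] lin_intros G)
  also have "\<dots> = SB a (\<lambda>a1 a2. SB a1 (\<lambda>a11 a12. SB b (\<lambda>b1 b2. SB b1 (\<lambda>b11 b12.
        SC a2 (\<lambda>g a20. SH g (\<lambda>g1 g2. SC a12 (\<lambda>h a120.
          G a11 (act B h (act B g1 b11)) a120 (act B g2 b12) a20 b2)))))))"
    by (simp only: sweedler_commute[of H B _ B B] sweedler_commute[of H H _ B B]
        sweedler_commute[of B B "bcomul B b" B B])
  also have "\<dots> = SB a (\<lambda>a1 a'. SB a' (\<lambda>a2 a3. SB b (\<lambda>b1 b2. SB b1 (\<lambda>b11 b12.
        SC a3 (\<lambda>g a30. SH g (\<lambda>g1 g2. SC a2 (\<lambda>h a20.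
          G a1 (act B h (act B g1 b11)) a20 (act B g2 b12) a30 b2)))))))"
    by (intro coassoc[where X = D] lin_intros G)
  also have "\<dots> = SB a (\<lambda>a1 a'. SB a' (\<lambda>a2 a3. SB b (\<lambda>b1 b'. SB b' (\<lambda>b2 b3.
        SC a3 (\<lambda>g a30. SH g (\<lambda>g1 g2. SC a2 (\<lambda>h a20.
          G a1 (act B h (act B g1 b1)) a20 (act B g2 b2) a30 b3)))))))"
    by (rule sweedler_cong, rule sweedler_cong) (intro coassoc[where X = D] lin_intros G)
  also have "\<dots> = SB a (\<lambda>a1 a'. SB a' (\<lambda>a2 a3. SB b (\<lambda>b1 b'. SB b' (\<lambda>b2 b3.
        SC a3 (\<lambda>g a3'. SC a3' (\<lambda>g' a30. SC a2 (\<lambda>h a20.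
          G a1 (act B h (act B g b1)) a20 (act B g' b2) a30 b3)))))))"
    by (intro sweedler_cong coact_coassoc[where D = D] lin_intros G)
  also have "\<dots> = bsweedler3 a b G"
    unfolding bsweedler3_def by (intro sweedler_cong, subst sweedler_commute, intro sweedler_cong)
      (rule sweedler_commute)
  finally show ?thesis .
qed

lemma bsweedler_right_nested:
  assumes "hexalin B D G"
  shows "bsweedler H B a b (\<lambda>a1 b1 a2 b2. bsweedler H B a2 b2 (G a1 b1)) = bsweedler3 a b G"
proof -
  note G = hexalin_lin[OF assms, THEN lin_compose]
  have "bsweedler H B a b (\<lambda>a1 b1 a2 b2. bsweedler H B a2 b2 (G a1 b1))
     = SB a (\<lambda>a1 a'. SB b (\<lambda>b1 b'. SB a' (\<lambda>a2 a3. SC a2 (\<lambda>h a20. SC a3 (\<lambda>g a3'. SB b' (\<lambda>b2 b3.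
         SC a3' (\<lambda>g' a30. G a1 (act B (hmul H h g) b1) a20 (act B g' b2) a30 b3)))))))"
    unfolding bsweedler_def by (intro sweedler_cong coact_bcomul[where D = D] lin_intros G)
  also have "\<dots> = bsweedler3 a b G"
    unfolding bsweedler3_def
    by (simp only: sweedler_commute[of H B _ B B] sweedler_commute[of B B "bcomul B b" B B]
        act_hmul)
  finally show ?thesis .
qed

end

section \<open>Braided comodule algebras\<close>

locale braided_comodule_algebra = braided_hopf_algebra H B
  for H :: "('k::field, 'h::ab_group_add) hopf" and B :: "('k, 'h, 'b::ab_group_add) bhopf" +
  fixes E :: "('k, 'h, 'e::ab_group_add, 'b) comod_alg"
  assumes comod_alg: "comodule_algebra H B E"
begin

sublocale convolution_algebra B "bcomul B" "bcounit B" E "cmul E" "cone E"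
  using comod_alg coalgebra_B
  by unfold_locales (simp_all add: comodule_algebra_def h_module_algebra_def)

abbreviation SE where "SE e \<equiv> sweedler E B (rho E e)"

lemma vspace_E [simp]: "vspace E"
  and bilin_actE: "bilin H E E (act E)"
  and lin_rho: "lin E TT (rho E)" and rho_tspace: "rho E e \<in> tspace E B"
  and act_cmul: "act E h (cmul E d e) = SH h (\<lambda>h1 h2. cmul E (act E h1 d) (act E h2 e))"
  and rho_cone: "rho E (cone E) = tens E B (cone E) (bone B)"
  using comod_alg
  by (auto simp: comodule_algebra_def assoc_algebra_def h_module_def h_module_algebra_def)

lemmas lin_opsE [lin_intros] =
  lin_sweedler_tensor[OF lin_compose[OF lin_rho] rho_tspace]
  bilin_lin_left[OF bilin_actE] bilin_lin_right[OF bilin_actE]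
  lin_compose[OF lin_rho]

lemma rho_coassoc:
  assumes "trilin E B B D F"
  shows "SE e (\<lambda>e' c. SE e' (\<lambda>e0 b. F e0 b c)) = SE e (\<lambda>e0 b. SB b (F e0))"
proof -
  obtain \<Phi> where \<Phi>: "lin TT D \<Phi>"
    "\<And>a t. t \<in> tspace B B \<Longrightarrow> \<Phi> (tens E TT a t) = sweedler B B t (F a)"
    using trilin_tensor_lift[OF assms] by blast
  have F: "bilin B B D (F a)" for a using assms by (simp add: trilin_def)
  have "SE e (\<lambda>e' c. SE e' (\<lambda>e0 b. tens E TT e0 (tens B B b c)))
      = SE e (\<lambda>e0 b. tens E TT e0 (bcomul B b))"
    using comod_alg by (simp add: comodule_algebra_def)
  from arg_cong[OF this, of \<Phi>] show ?thesis
    by (simp add: lin_sweedler[OF \<Phi>(1)] \<Phi>(2) tens_in_tspace sweedler_tens[OF F] bcomul_tspace)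
qed

lemma rho_counit:
  assumes "lin E D F" shows "SE e (\<lambda>e0 b. scale D (bcounit B b) (F e0)) = F e"
proof -
  have "F (SE e (\<lambda>e0 b. scale E (bcounit B b) e0)) = F e"
    using comod_alg by (simp add: comodule_algebra_def)
  then show ?thesis by (simp add: lin_sweedler[OF assms] lin_scale[OF assms])
qed

lemma rho_cmul:
  assumes "bilin E B D F"
  shows "SE (cmul E d e) F = SE d (\<lambda>d0 d1. SE e (\<lambda>e0 e1. SC d1 (\<lambda>g d10.
            F (cmul E d0 (act E g e0)) (bmul B d10 e1))))"
proof -
  have "rho E (cmul E d e) = SE d (\<lambda>d0 d1. SE e (\<lambda>e0 e1. SC d1 (\<lambda>g d10.
            tens E B (cmul E d0 (act E g e0)) (bmul B d10 e1))))"
    using comod_alg by (simp add: comodule_algebra_def)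
  then show ?thesis
    by (simp add: sweedler_bind[OF assms] sweedler_in_tspace tens_in_tspace sweedler_tens[OF assms])
qed

lemma conv_invertible_iff:
  "conv_invertible B E f \<longleftrightarrow> (\<exists>g. lin B E g
     \<and> conv f g = scalar_map (bcounit B) \<and> conv g f = scalar_map (bcounit B))"
  by (simp add: conv_invertible_def conv_def scalar_map_def fun_eq_iff)

subsection \<open>Convolution of maps on the braided tensor square\<close>

definition bconv :: "('b \<Rightarrow> 'b \<Rightarrow> 'e) \<Rightarrow> ('b \<Rightarrow> 'b \<Rightarrow> 'e) \<Rightarrow> 'b \<Rightarrow> 'b \<Rightarrow> 'e" where
  "bconv f g a b = bsweedler H B a b (\<lambda>a1 b1 a2 b2. cmul E (f a1 b1) (g a2 b2))"

definition scalar_form :: "('b \<Rightarrow> 'b \<Rightarrow> 'k) \<Rightarrow> 'b \<Rightarrow> 'b \<Rightarrow> 'e" where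
  "scalar_form \<sigma> a b = scale E (\<sigma> a b) (cone E)"

abbreviation bconv_unit :: "'b \<Rightarrow> 'b \<Rightarrow> 'e" where
  "bconv_unit \<equiv> scalar_form (\<lambda>a b. bcounit B a * bcounit B b)"

lemma bilin_bconv:
  assumes "bilin B B E f" "bilin B B E g" shows "bilin B B E (bconv f g)"
  unfolding bconv_def[abs_def] bsweedler_def
  by (intro lin_intros assms[THEN bilin_lin_left] assms[THEN bilin_lin_right])

lemma bilin_scalar_form:
  assumes "bilin B B ground \<sigma>" shows "bilin B B E (scalar_form \<sigma>)"
  unfolding scalar_form_def[abs_def]
  using assms by (intro lin_intros) (auto simp: bilin_def)

lemma bconv_assoc:
  assumes "bilin B B E f" "bilin B B E g" "bilin B B E h"
  shows "bconv (bconv f g) h = bconv f (bconv g h)"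
proof (intro ext)
  fix a b
  let ?G = "\<lambda>a1 b1 a2 b2 a3 b3. cmul E (f a1 b1) (cmul E (g a2 b2) (h a3 b3))"
  have G: "hexalin B E ?G"
    by (intro lin_intros assms[THEN bilin_lin_left] assms[THEN bilin_lin_right])
  have "bconv (bconv f g) h a b
      = bsweedler H B a b (\<lambda>a1 b1 a2 b2. bsweedler H B a1 b1 (\<lambda>u v w z. ?G u v w z a2 b2))"
    unfolding bconv_def by (simp only: mul_sweedler bsweedler_def mul_assoc)
  also have "\<dots> = bsweedler H B a b (\<lambda>a1 b1 a2 b2. bsweedler H B a2 b2 (?G a1 b1))"
    unfolding bsweedler_left_nested[OF G] bsweedler_right_nested[OF G] ..
  also have "\<dots> = bconv f (bconv g h) a b"
    unfolding bconv_def by (simp only: mul_sweedler bsweedler_def)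
  finally show "bconv (bconv f g) h a b = bconv f (bconv g h) a b" .
qed

lemma bconv_scalar_form_left:
  "bconv (scalar_form \<sigma>) f a b = bsweedler H B a b (\<lambda>a1 b1 a2 b2. scale E (\<sigma> a1 b1) (f a2 b2))"
  by (simp add: bconv_def scalar_form_def mul_scale mul_one)

lemma bconv_scalar_form_right:
  "bconv f (scalar_form \<sigma>) a b = bsweedler H B a b (\<lambda>a1 b1 a2 b2. scale E (\<sigma> a2 b2) (f a1 b1))"
  by (simp add: bconv_def scalar_form_def mul_scale mul_one)

lemma bconv_unit_right:
  assumes "bilin B B E f" shows "bconv f bconv_unit = f"
proof (intro ext)
  fix a b
  note f = assms[THEN bilin_lin_left] assms[THEN bilin_lin_right]
  have "bconv f bconv_unit a b = SB a (\<lambda>a1 a2. SB b (\<lambda>b1 b2. SC a2 (\<lambda>g w.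
      scale E (bcounit B w) (scale E (bcounit B b2) (f a1 (act B g b1))))))"
    by (simp add: bconv_scalar_form_right bsweedler_def scale_scale)
  also have "\<dots> = SB a (\<lambda>a1 a2. SB b (\<lambda>b1 b2.
      scale E (bcounit B a2) (scale E (bcounit B b2) (f a1 (act B (hone H) b1)))))"
    by (intro sweedler_cong bcounit_coact lin_intros f)
  also have "\<dots> = SB a (\<lambda>a1 a2. SB b (\<lambda>b1 b2.
      scale E (bcounit B b2) (scale E (bcounit B a2) (f a1 b1))))"
    by (simp add: act_one scale_scale mult.commute)
  also have "\<dots> = SB a (\<lambda>a1 a2. scale E (bcounit B a2) (f a1 b))"
    by (intro sweedler_cong bcounit_right lin_intros f)
  also have "\<dots> = f a b"
    by (intro bcounit_right lin_intros f)
  finally show "bconv f bconv_unit a b = f a b" .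
qed

lemma bconv_unit_left:
  assumes "bilin B B E f" shows "bconv bconv_unit f = f"
proof (intro ext)
  fix a b
  note f = assms[THEN bilin_lin_left] assms[THEN bilin_lin_right]
  have "bconv bconv_unit f a b = SB a (\<lambda>a1 a2. SB b (\<lambda>b1 b2. SC a2 (\<lambda>g w.
      scale E (hcounit H g) (scale E (bcounit B b1) (scale E (bcounit B a1) (f w b2))))))"
    by (simp add: bconv_scalar_form_left bsweedler_def scale_scale bcounit_act mult_ac)
  also have "\<dots> = SB a (\<lambda>a1 a2. SB b (\<lambda>b1 b2.
      scale E (bcounit B b1) (scale E (bcounit B a1) (f a2 b2))))"
    by (intro sweedler_cong hcounit_coact lin_intros f)
  also have "\<dots> = SB a (\<lambda>a1 a2. scale E (bcounit B a1) (f a2 b))"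
    by (intro sweedler_cong bcounit_left lin_intros f)
  also have "\<dots> = f a b"
    by (intro bcounit_left lin_intros f)
  finally show "bconv bconv_unit f a b = f a b" .
qed

lemma scalar_form_conv_inverse:
  assumes G: "bilin B B E G"
    and inverse: "bconv (scalar_form \<sigma>) G = bconv_unit" "bconv G (scalar_form \<sigma>) = bconv_unit"
    and \<phi>: "lin E ground \<phi>" "\<phi> (cone E) = 1"
  obtains \<sigma>' where "bilin B B ground \<sigma>'"
    "\<And>a b. bsweedler H B a b (\<lambda>a1 b1 a2 b2. \<sigma> a1 b1 * \<sigma>' a2 b2) = bcounit B a * bcounit B b"
    "\<And>a b. bsweedler H B a b (\<lambda>a1 b1 a2 b2. \<sigma>' a1 b1 * \<sigma> a2 b2) = bcounit B a * bcounit B b"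
proof
  have \<phi>_scale: "\<phi> (scale E c e) = c * \<phi> e" for c e using lin_scale[OF \<phi>(1)] by simp
  show "bilin B B ground (\<lambda>a b. \<phi> (G a b))" by (rule bilin_functional[OF G \<phi>(1)])
  fix a b
  show "bsweedler H B a b (\<lambda>a1 b1 a2 b2. \<sigma> a1 b1 * \<phi> (G a2 b2)) = bcounit B a * bcounit B b"
    using arg_cong[OF fun_cong[OF fun_cong[OF inverse(1)]], of \<phi> a b]
    by (simp add: bconv_scalar_form_left lin_bsweedler[OF \<phi>(1)] scalar_form_def \<phi>_scale \<phi>(2))
  show "bsweedler H B a b (\<lambda>a1 b1 a2 b2. \<phi> (G a1 b1) * \<sigma> a2 b2) = bcounit B a * bcounit B b"
    using arg_cong[OF fun_cong[OF fun_cong[OF inverse(2)]], of \<phi> a b]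
    by (simp add: bconv_scalar_form_right lin_bsweedler[OF \<phi>(1)] scalar_form_def \<phi>_scale \<phi>(2)
        mult.commute)
qed

definition outer_mul :: "('b \<Rightarrow> 'e) \<Rightarrow> 'b \<Rightarrow> 'b \<Rightarrow> 'e" where
  "outer_mul f a b = cmul E (f a) (f b)"

definition braided_outer_mul :: "('b \<Rightarrow> 'e) \<Rightarrow> 'b \<Rightarrow> 'b \<Rightarrow> 'e" where
  "braided_outer_mul f a b = SC a (\<lambda>g a0. cmul E (f (act B g b)) (f a0))"

definition inner_mul :: "('b \<Rightarrow> 'e) \<Rightarrow> 'b \<Rightarrow> 'b \<Rightarrow> 'e" where
  "inner_mul f a b = f (bmul B a b)"

lemma bilin_muls:
  assumes "lin B E f"
  shows "bilin B B E (outer_mul f)" "bilin B B E (braided_outer_mul f)" "bilin B B E (inner_mul f)"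
  unfolding outer_mul_def[abs_def] braided_outer_mul_def[abs_def] inner_mul_def[abs_def]
  by (intro lin_intros lin_compose[OF assms])+

context
  fixes f g :: "'b \<Rightarrow> 'e"
  assumes lin_f: "lin B E f" and lin_g: "lin B E g" and conv_fg: "conv f g = scalar_map (bcounit B)"
begin

lemma inverse_eval: "SB b (\<lambda>x y. cmul E (f x) (g y)) = scale E (bcounit B b) (cone E)"
  using fun_cong[OF conv_fg, of b] by (simp add: conv_def scalar_map_def)

lemmas lin_fg = lin_intros lin_compose[OF lin_f] lin_compose[OF lin_g]

lemma bconv_inner_mul: "bconv (inner_mul f) (inner_mul g) = bconv_unit"
proof (intro ext)
  fix a b
  have "bconv (inner_mul f) (inner_mul g) a b = SB (bmul B a b) (\<lambda>x y. cmul E (f x) (g y))"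
    unfolding bconv_def inner_mul_def
    by (rule bcomul_bmul[symmetric, where D = E]) (intro lin_fg)
  then show "bconv (inner_mul f) (inner_mul g) a b = bconv_unit a b"
    by (simp add: inverse_eval bcounit_bmul scalar_form_def)
qed

lemma bconv_outer_braided: "bconv (outer_mul f) (braided_outer_mul g) = bconv_unit"
proof (intro ext)
  fix a b
  have "bconv (outer_mul f) (braided_outer_mul g) a b
    = SB a (\<lambda>a1 a2. SB b (\<lambda>b1 b2. SC a2 (\<lambda>g' w. SC w (\<lambda>h v.
        cmul E (cmul E (f a1) (f (act B g' b1))) (cmul E (g (act B h b2)) (g v))))))"
    unfolding bconv_def bsweedler_def outer_mul_def braided_outer_mul_def
    by (simp only: mul_sweedler)
  also have "\<dots> = SB a (\<lambda>a1 a2. SB b (\<lambda>b1 b2. SC a2 (\<lambda>h w. SH h (\<lambda>h1 h2.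
        cmul E (cmul E (f a1) (f (act B h1 b1))) (cmul E (g (act B h2 b2)) (g w))))))"
    by (intro sweedler_cong coact_coassoc[where D = E, symmetric] lin_fg)
  also have "\<dots> = SB a (\<lambda>a1 a2. SC a2 (\<lambda>h w. cmul E (f a1) (cmul E (SH h (\<lambda>h1 h2. SB b (\<lambda>b1 b2.
        cmul E (f (act B h1 b1)) (g (act B h2 b2))))) (g w))))"
    by (simp only: mul_sweedler sweedler_commute[of B B "bcomul B b"] mul_assoc)
  also have "\<dots> = SB a (\<lambda>a1 a2. SC a2 (\<lambda>h w. cmul E (f a1) (cmul E
        (SB (act B h b) (\<lambda>x y. cmul E (f x) (g y))) (g w))))"
    by (intro sweedler_cong arg_cong2[where f = "cmul E"] refl
        bcomul_act[where D = E, symmetric] lin_fg)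
  also have "\<dots> = SB a (\<lambda>a1 a2. SC a2 (\<lambda>h w.
        scale E (hcounit H h) (scale E (bcounit B b) (cmul E (f a1) (g w)))))"
    by (simp only: inverse_eval mul_scale mul_one bcounit_act scale_scale[OF vspace_E])
  also have "\<dots> = SB a (\<lambda>a1 a2. scale E (bcounit B b) (cmul E (f a1) (g a2)))"
    by (intro sweedler_cong hcounit_coact lin_fg)
  also have "\<dots> = scale E (bcounit B b) (SB a (\<lambda>a1 a2. cmul E (f a1) (g a2)))"
    by (rule lin_sweedler[where C = E and D = E, symmetric]) (intro lin_fg)
  also have "\<dots> = bconv_unit a b"
    by (simp add: inverse_eval scalar_form_def scale_scale mult.commute)
  finally show "bconv (outer_mul f) (braided_outer_mul g) a b = bconv_unit a b" .
qed

lemma bconv_braided_outer: "bconv (braided_outer_mul f) (outer_mul g) = bconv_unit"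
proof (intro ext)
  fix a b
  have "bconv (braided_outer_mul f) (outer_mul g) a b
    = SB a (\<lambda>a1 a2. SB b (\<lambda>b1 b2. SC a2 (\<lambda>g' v. SC a1 (\<lambda>h u.
        cmul E (cmul E (f (act B h (act B g' b1))) (f u)) (cmul E (g v) (g b2))))))"
    unfolding bconv_def bsweedler_def outer_mul_def braided_outer_mul_def
    by (simp only: mul_sweedler)
  also have "\<dots> = SB a (\<lambda>a1 a2. SB b (\<lambda>b1 b2. SC a1 (\<lambda>h u. SC a2 (\<lambda>g' v.
        cmul E (cmul E (f (act B (hmul H h g') b1)) (f u)) (cmul E (g v) (g b2))))))"
    unfolding act_hmul by (rule sweedler_cong, rule sweedler_cong, rule sweedler_commute)
  also have "\<dots> = SB b (\<lambda>b1 b2. SB a (\<lambda>a1 a2. SC a1 (\<lambda>h u. SC a2 (\<lambda>g' v.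
        cmul E (cmul E (f (act B (hmul H h g') b1)) (f u)) (cmul E (g v) (g b2))))))"
    by (rule sweedler_commute)
  also have "\<dots> = SB b (\<lambda>b1 b2. SC a (\<lambda>h w. SB w (\<lambda>u v.
        cmul E (cmul E (f (act B h b1)) (f u)) (cmul E (g v) (g b2)))))"
    by (intro sweedler_cong coact_bcomul[where D = E, symmetric] lin_fg)
  also have "\<dots> = SB b (\<lambda>b1 b2. SC a (\<lambda>h w. cmul E (f (act B h b1))
        (cmul E (SB w (\<lambda>u v. cmul E (f u) (g v))) (g b2))))"
    by (simp only: mul_sweedler mul_assoc)
  also have "\<dots> = SB b (\<lambda>b1 b2. SC a (\<lambda>h w.
        scale E (bcounit B w) (cmul E (f (act B h b1)) (g b2))))"
    by (simp only: inverse_eval mul_scale mul_one)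
  also have "\<dots> = SB b (\<lambda>b1 b2. scale E (bcounit B a) (cmul E (f (act B (hone H) b1)) (g b2)))"
    by (intro sweedler_cong bcounit_coact lin_fg)
  also have "\<dots> = scale E (bcounit B a) (SB b (\<lambda>b1 b2. cmul E (f b1) (g b2)))"
    unfolding act_one by (rule lin_sweedler[where C = E and D = E, symmetric]) (intro lin_fg)
  also have "\<dots> = bconv_unit a b"
    by (simp add: inverse_eval scalar_form_def scale_scale)
  finally show "bconv (braided_outer_mul f) (outer_mul g) a b = bconv_unit a b" .
qed

end

subsection \<open>Colinear maps\<close>

definition colinear :: "('b \<Rightarrow> 'e) \<Rightarrow> bool" where
  "colinear f \<longleftrightarrow> (\<forall>b. rho E (f b) = tmap B B E B f id (bcomul B b))"

lemma sweedler_rho_colinear: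
  assumes "colinear f" "bilin E B D F" shows "SE (f b) F = SB b (\<lambda>x y. F (f x) y)"
  using assms(1) by (simp add: colinear_def sweedler_tmap[OF assms(2)])

definition colinear_defect :: "('b \<Rightarrow> 'e) \<Rightarrow> 'b \<Rightarrow> ('k, 'e, 'b) tensor" where
  "colinear_defect f b = rho E (f b) - tmap B B E B f id (bcomul B b)"

lemma colinear_defect_tspace: "colinear_defect f b \<in> tspace E B"
  unfolding colinear_defect_def by (intro tspace_diff rho_tspace tmap_in_tspace vspace_E vspace_B)

lemma lin_tmap_id_bcomul:
  assumes "lin B E f" shows "lin B TT (\<lambda>b. tmap B B E B f id (bcomul B b))"
  by (intro lin_tmap lin_bcomul bcomul_tspace assms lin_id vspace_B)

lemma lin_colinear_defect:
  assumes "lin B E f" shows "lin B TT (colinear_defect f)"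
  unfolding colinear_defect_def[abs_def]
  by (intro lin_fun_diff lin_compose[OF lin_rho] lin_tmap_id_bcomul assms)

lemma sweedler_colinear_defect:
  assumes "bilin E B D F"
  shows "sweedler E B (colinear_defect f b) F = SE (f b) F - SB b (\<lambda>x y. F (f x) y)"
  by (simp add: colinear_defect_def sweedler_tensor_diff[OF assms] rho_tspace tmap_in_tspace
      sweedler_tmap[OF assms])

definition slice :: "('e \<Rightarrow> 'k) \<Rightarrow> 'e \<Rightarrow> 'b" where
  "slice \<phi> e = SE e (\<lambda>e0 b. scale B (\<phi> e0) b)"

lemma lin_slice:
  assumes "lin E ground \<phi>" shows "lin E B (slice \<phi>)"
  unfolding slice_def[abs_def] by (intro lin_intros lin_compose[OF assms])

lemma bcomul_slice:
  assumes \<phi>: "lin E ground \<phi>"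
  shows "bcomul B (slice \<phi> e) = tmap E B B B (slice \<phi>) id (rho E e)"
proof -
  have tens_lin: "lin B TT (\<lambda>b. tens B B b c)" for c by (intro lin_intros)
  have "bcomul B (slice \<phi> e) = SE e (\<lambda>e0 b. scale TT (\<phi> e0) (SB b (tens B B)))"
    unfolding slice_def lin_sweedler[OF lin_bcomul] lin_scale[OF lin_bcomul]
    by (simp add: sweedler_tens_ident bcomul_tspace)
  also have "\<dots> = SE e (\<lambda>e0 b. SB b (\<lambda>u v. scale TT (\<phi> e0) (tens B B u v)))"
    by (intro sweedler_cong lin_sweedler[where C = TT and D = TT] lin_intros)
  also have "\<dots> = SE e (\<lambda>e' c. SE e' (\<lambda>e0 b. scale TT (\<phi> e0) (tens B B b c)))"
    by (rule rho_coassoc[where D = TT, symmetric]) (intro lin_intros lin_compose[OF \<phi>])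
  also have "\<dots> = tmap E B B B (slice \<phi>) id (rho E e)"
    unfolding tmap_def slice_def lin_sweedler[OF tens_lin] lin_scale[OF tens_lin] id_apply ..
  finally show ?thesis .
qed

definition colinear_ratio :: "('b \<Rightarrow> 'e) \<Rightarrow> ('b \<Rightarrow> 'e) \<Rightarrow> 'b \<Rightarrow> 'k" where
  "colinear_ratio f g b = bcounit B (inv g (f b))"

lemma lin_colinear_ratio:
  assumes "lin B E f" "lin B E g" "bij g" shows "lin B ground (colinear_ratio f g)"
  unfolding colinear_ratio_def[abs_def]
  by (intro lin_compose[OF lin_bcounit] lin_compose[OF lin_inv[OF assms(2,3)]] assms(1))

lemma colinear_ratio_conv:
  assumes g: "lin B E g" "bij g" "colinear g" and f: "colinear f"
  shows "conv (scalar_map (colinear_ratio f g)) g = f"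
proof
  fix b
  let ?F = "\<lambda>e c. scale E (bcounit B (inv g e)) (g c)"
  have F: "bilin E B E ?F"
    by (intro lin_intros lin_compose[OF g(1)] lin_compose[OF lin_inv[OF g(1,2)]])
  obtain c where c: "f b = g c" using g(2) by (metis bij_pointE)
  have "conv (scalar_map (colinear_ratio f g)) g b = SB b (\<lambda>x y. ?F (f x) y)"
    by (simp add: conv_scalar_map_left colinear_ratio_def)
  also have "\<dots> = SB c (\<lambda>x y. ?F (g x) y)"
    using sweedler_rho_colinear[OF f F, of b] sweedler_rho_colinear[OF g(3) F, of c] c by simp
  also have "\<dots> = f b"
    by (simp add: bij_is_inj[OF g(2)] bcounit_left[OF g(1)] c)
  finally show "conv (scalar_map (colinear_ratio f g)) g b = f b" .
qed

lemma conv_colinear_ratio_inverse: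
  assumes f: "lin B E f" "bij f" "colinear f" and g: "lin B E g" "bij g" "colinear g"
  shows "conv (scalar_map (colinear_ratio f g)) (scalar_map (colinear_ratio g f))
    = scalar_map (bcounit B)"
proof -
  have counit: "lin E ground (\<lambda>e. bcounit B (inv f e))"
    by (intro lin_compose[OF lin_bcounit] lin_inv f)
  have "SB b (\<lambda>x y. colinear_ratio f g x * colinear_ratio g f y) = bcounit B b" for b
    using arg_cong[OF fun_cong[OF colinear_ratio_conv[OF g f(3)]], of "\<lambda>e. bcounit B (inv f e)" b]
    by (simp add: conv_scalar_map_left lin_sweedler[OF counit] lin_scale[OF counit]
        bij_is_inj[OF f(2)] colinear_ratio_def[of g f])
  then show ?thesis by (simp add: conv_scalar_maps lin_colinear_ratio f g)
qed

lemma colinear_bij_conv_invertible: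
  assumes g: "lin B E g" "bij g" "colinear g" "conv_invertible B E g"
    and f: "lin B E f" "bij f" "colinear f"
  shows "conv_invertible B E f"
proof -
  obtain g' where g': "lin B E g'" "conv g g' = scalar_map (bcounit B)"
    "conv g' g = scalar_map (bcounit B)"
    using g(4) conv_invertible_iff by blast
  define r s where "r = scalar_map (colinear_ratio f g)" and "s = scalar_map (colinear_ratio g f)"
  have lin_rs: "lin B E r" "lin B E s"
    unfolding r_def s_def by (intro lin_scalar_map lin_colinear_ratio f g)+
  have f_eq: "f = conv r g" and g_eq: "g = conv s f"
    unfolding r_def s_def by (simp_all add: colinear_ratio_conv f g)
  have rs: "conv r s = scalar_map (bcounit B)"
    unfolding r_def s_def by (intro conv_colinear_ratio_inverse f g)
  have "conv f (conv g' s) = conv r (conv (conv g g') s)"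
    unfolding f_eq by (simp add: conv_assoc lin_conv lin_rs g(1) g'(1))
  also have "\<dots> = scalar_map (bcounit B)"
    by (simp add: g'(2) conv_unit_left[OF lin_rs(2)] rs)
  finally have right: "conv f (conv g' s) = scalar_map (bcounit B)" .
  have "conv (conv g' s) f = conv g' (conv s f)" by (intro conv_assoc g' lin_rs f)
  then have left: "conv (conv g' s) f = scalar_map (bcounit B)" by (simp flip: g_eq add: g'(3))
  show ?thesis
    unfolding conv_invertible_iff using left right lin_conv[OF g'(1) lin_rs(2)] by blast
qed

end

section \<open>The cocycle of a section\<close>

locale cleft_section = braided_comodule_algebra H B E
  for H :: "('k::field, 'h::ab_group_add) hopf" and B :: "('k, 'h, 'b::ab_group_add) bhopf"
    and E :: "('k, 'h, 'e::ab_group_add, 'b) comod_alg" +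
  fixes \<omega> :: "'b \<Rightarrow> 'e" and \<epsilon>0 :: "'e \<Rightarrow> 'k"
  assumes h_linear_\<omega>: "h_linear B E \<omega>" and bij_\<omega>: "bij \<omega>" and \<omega>_bone: "\<omega> (bone B) = cone E"
    and colinear_\<omega>: "colinear \<omega>" and conv_invertible_\<omega>: "conv_invertible B E \<omega>"
    and lin_\<epsilon>0: "lin E ground \<epsilon>0" and \<epsilon>0_\<omega>: "\<epsilon>0 (\<omega> b) = bcounit B b"
begin

lemma lin_\<omega>: "lin B E \<omega>" and \<omega>_act: "\<omega> (act B h b) = act E h (\<omega> b)"
  using h_linear_\<omega> by (auto simp: h_linear_def)

lemmas lin_ops\<omega> [lin_intros] = lin_compose[OF lin_\<omega>] lin_compose[OF lin_\<epsilon>0]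

definition \<sigma> :: "'b \<Rightarrow> 'b \<Rightarrow> 'k" where
  "\<sigma> a b = \<epsilon>0 (cmul E (\<omega> a) (\<omega> b))"

abbreviation twisted_mul :: "'b \<Rightarrow> 'b \<Rightarrow> 'b" where
  "twisted_mul \<equiv> cmul (cocycle_twist H B \<sigma>)"

lemma twisted_mul_eq:
  "twisted_mul a b = bsweedler H B a b (\<lambda>a1 b1 a2 b2. scale B (\<sigma> a1 b1) (bmul B a2 b2))"
  by (simp add: cocycle_twist_def)

lemma bilin_\<sigma>: "bilin B B ground \<sigma>"
  unfolding \<sigma>_def[abs_def] by (intro lin_intros)

lemma \<omega>_inverse: "SE (\<omega> b) (\<lambda>e c. scale B (\<epsilon>0 e) c) = b"
proof -
  have "SE (\<omega> b) (\<lambda>e c. scale B (\<epsilon>0 e) c) = SB b (\<lambda>x y. scale B (\<epsilon>0 (\<omega> x)) y)"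
    by (rule sweedler_rho_colinear[OF colinear_\<omega>, where D = B]) (intro lin_intros)
  also have "\<dots> = b" unfolding \<epsilon>0_\<omega> by (rule bcounit_left) (intro lin_intros)
  finally show ?thesis .
qed

lemma \<omega>_twisted_mul: "\<omega> (twisted_mul a b) = cmul E (\<omega> a) (\<omega> b)"
proof -
  note SE_\<omega> = sweedler_rho_colinear[OF colinear_\<omega>, where D = B]
  obtain z where z: "cmul E (\<omega> a) (\<omega> b) = \<omega> z" using bij_\<omega> by (metis bij_pointE)
  have "z = SE (cmul E (\<omega> a) (\<omega> b)) (\<lambda>e c. scale B (\<epsilon>0 e) c)"
    by (simp add: z \<omega>_inverse)
  also have "\<dots> = SE (\<omega> a) (\<lambda>d0 d1. SE (\<omega> b) (\<lambda>e0 e1. SC d1 (\<lambda>g d10.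
            scale B (\<epsilon>0 (cmul E d0 (act E g e0))) (bmul B d10 e1))))"
    by (rule rho_cmul[where D = B]) (intro lin_intros)
  also have "\<dots> = SB a (\<lambda>a1 a2. SE (\<omega> b) (\<lambda>e0 e1. SC a2 (\<lambda>g d10.
            scale B (\<epsilon>0 (cmul E (\<omega> a1) (act E g e0))) (bmul B d10 e1))))"
    by (rule SE_\<omega>) (intro lin_intros)
  also have "\<dots> = SB a (\<lambda>a1 a2. SB b (\<lambda>b1 b2. SC a2 (\<lambda>g d10.
            scale B (\<epsilon>0 (cmul E (\<omega> a1) (act E g (\<omega> b1)))) (bmul B d10 b2))))"
    by (intro sweedler_cong SE_\<omega> lin_intros)
  also have "\<dots> = twisted_mul a b"
    by (simp add: twisted_mul_eq \<sigma>_def bsweedler_def \<omega>_act)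
  finally show ?thesis using z by simp
qed

lemma \<sigma>_twisted_mul_left:
  "\<sigma> (twisted_mul x y) z = bsweedler H B x y (\<lambda>x1 y1 x2 y2. \<sigma> x1 y1 * \<sigma> (bmul B x2 y2) z)"
proof -
  have lin: "lin B ground (\<lambda>x. \<sigma> x z)" using bilin_\<sigma> by (simp add: bilin_def)
  show ?thesis unfolding twisted_mul_eq lin_bsweedler[OF lin] lin_scale[OF lin] by simp
qed

lemma \<sigma>_twisted_mul_right:
  "\<sigma> x (twisted_mul y z) = bsweedler H B y z (\<lambda>y1 z1 y2 z2. \<sigma> y1 z1 * \<sigma> x (bmul B y2 z2))"
proof -
  have lin: "lin B ground (\<sigma> x)" using bilin_\<sigma> by (simp add: bilin_def)
  show ?thesis unfolding twisted_mul_eq lin_bsweedler[OF lin] lin_scale[OF lin] by simp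
qed

lemma \<sigma>_cocycle: "\<sigma> (twisted_mul x y) z = \<sigma> x (twisted_mul y z)"
  by (simp add: \<sigma>_def \<omega>_twisted_mul mul_assoc)

lemma \<epsilon>0_act: "\<epsilon>0 (act E h e) = hcounit H h * \<epsilon>0 e"
proof -
  obtain b where "e = \<omega> b" using bij_\<omega> by (metis bij_pointE)
  then show ?thesis by (simp flip: \<omega>_act add: \<epsilon>0_\<omega> bcounit_act)
qed

lemma \<sigma>_h_linear: "SH h (\<lambda>h1 h2. \<sigma> (act B h1 a) (act B h2 b)) = hcounit H h * \<sigma> a b"
  unfolding \<sigma>_def \<epsilon>0_act[symmetric] act_cmul lin_sweedler[OF lin_\<epsilon>0] \<omega>_act ..

lemma \<sigma>_normalized: "\<sigma> x (bone B) = bcounit B x" "\<sigma> (bone B) x = bcounit B x"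
  by (simp_all add: \<sigma>_def \<omega>_bone mul_one \<epsilon>0_\<omega>)

lemma \<epsilon>0_cone: "\<epsilon>0 (cone E) = 1"
  using \<epsilon>0_\<omega>[of "bone B"] by (simp add: \<omega>_bone bcounit_bone)

lemma bconv_\<sigma>_inner_mul: "bconv (scalar_form \<sigma>) (inner_mul \<omega>) = outer_mul \<omega>"
proof (intro ext)
  fix a b
  have "outer_mul \<omega> a b = \<omega> (twisted_mul a b)" by (simp add: outer_mul_def \<omega>_twisted_mul)
  then show "bconv (scalar_form \<sigma>) (inner_mul \<omega>) a b = outer_mul \<omega> a b"
    by (simp add: twisted_mul_eq lin_bsweedler[OF lin_\<omega>] lin_scale[OF lin_\<omega>]
        bconv_scalar_form_left inner_mul_def)
qed

lemma \<sigma>_bconv_inverse: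
  obtains G where "bilin B B E G"
    "bconv (scalar_form \<sigma>) G = bconv_unit" "bconv G (scalar_form \<sigma>) = bconv_unit"
proof -
  obtain \<omega>' where \<omega>': "lin B E \<omega>'" "conv \<omega> \<omega>' = scalar_map (bcounit B)"
    "conv \<omega>' \<omega> = scalar_map (bcounit B)"
    using conv_invertible_\<omega> conv_invertible_iff by blast
  let ?s = "scalar_form \<sigma>" and ?v = "inner_mul \<omega>" and ?v' = "inner_mul \<omega>'"
    and ?w = "outer_mul \<omega>" and ?w' = "braided_outer_mul \<omega>'"
  note bilins = bilin_bconv bilin_muls[OF lin_\<omega>] bilin_muls[OF \<omega>'(1)] bilin_scalar_form[OF bilin_\<sigma>]
  note inverses = bconv_inner_mul[OF lin_\<omega> \<omega>'(1,2)] bconv_outer_braided[OF lin_\<omega> \<omega>'(1,2)]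
    bconv_braided_outer[OF \<omega>'(1) lin_\<omega> \<omega>'(3)]
  have "?s = bconv (bconv ?s ?v) ?v'"
    by (simp add: bconv_assoc bilins inverses bconv_unit_right)
  then have s: "?s = bconv ?w ?v'" by (simp add: bconv_\<sigma>_inner_mul)
  have "bconv ?s (bconv ?v ?w') = bconv_unit"
    by (simp add: bconv_assoc[symmetric] bilins bconv_\<sigma>_inner_mul inverses)
  moreover have "bconv (bconv ?v ?w') ?s = bconv ?v (bconv (bconv ?w' ?w) ?v')"
    unfolding s by (simp add: bconv_assoc bilins)
  then have "bconv (bconv ?v ?w') ?s = bconv_unit"
    by (simp add: inverses bconv_unit_left bilins)
  ultimately show thesis using that[of "bconv ?v ?w'"] bilins by blast
qed

lemma \<sigma>_in_Z2: "\<sigma> \<in> Z2 H B"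
proof -
  obtain G where "bilin B B E G"
    "bconv (scalar_form \<sigma>) G = bconv_unit" "bconv G (scalar_form \<sigma>) = bconv_unit"
    by (rule \<sigma>_bconv_inverse)
  from scalar_form_conv_inverse[OF this lin_\<epsilon>0 \<epsilon>0_cone] obtain \<sigma>' where "bilin B B ground \<sigma>'"
    "\<And>a b. bsweedler H B a b (\<lambda>a1 b1 a2 b2. \<sigma> a1 b1 * \<sigma>' a2 b2) = bcounit B a * bcounit B b"
    "\<And>a b. bsweedler H B a b (\<lambda>a1 b1 a2 b2. \<sigma>' a1 b1 * \<sigma> a2 b2) = bcounit B a * bcounit B b"
    by blast
  then show ?thesis
    unfolding Z2_def mem_Collect_eq
    using bilin_\<sigma> \<sigma>_h_linear \<sigma>_normalized \<sigma>_cocycle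
    unfolding \<sigma>_twisted_mul_left \<sigma>_twisted_mul_right by blast
qed

lemma comod_alg_iso_cocycle_twist: "comod_alg_iso B E (cocycle_twist H B \<sigma>)"
proof -
  let ?F = "cocycle_twist H B \<sigma>"
  have F: "scale ?F = scale B" "act ?F = act B" "cone ?F = bone B" "rho ?F = bcomul B"
    by (simp_all add: cocycle_twist_def)
  have lin_F: "lin X ?F g \<longleftrightarrow> lin X B g" "lin ?F X h \<longleftrightarrow> lin B X h"
    for X :: "('k, 'x::ab_group_add, 'y) vect_scheme" and g h
    by (simp_all add: lin_def F)
  have tens_F: "tens ?F B = tens B B"
    by (intro ext) (simp add: tens_def bilin_def lin_F)
  define f where "f = inv \<omega>"
  have f: "f (\<omega> b) = b" "\<omega> (f e) = e" for b e
    using bij_\<omega> by (simp_all add: f_def bij_is_inj bij_is_surj surj_f_inv_f)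
  have lin_f: "lin E B f" unfolding f_def by (rule lin_inv[OF lin_\<omega> bij_\<omega>])
  have "h_linear E ?F f"
    unfolding h_linear_def F lin_F using lin_f by (metis f \<omega>_act)
  moreover have "bij f" using bij_\<omega> by (simp add: f_def bij_imp_bij_inv)
  moreover have "alg_hom E (cmul E) (cone E) ?F twisted_mul (cone ?F) f"
    unfolding alg_hom_def F lin_F using lin_f by (metis f \<omega>_twisted_mul \<omega>_bone)
  moreover have "rho ?F (f e) = tmap E B ?F B f id (rho E e)" for e
  proof -
    have "tmap E B ?F B f id (rho E (\<omega> (f e))) = SB (f e) (\<lambda>x y. tens B B (f (\<omega> x)) y)"
      unfolding tmap_def tens_F id_apply
      by (rule sweedler_rho_colinear[OF colinear_\<omega>, where D = TT])
        (intro lin_intros lin_compose[OF lin_f])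
    then show ?thesis by (simp add: f F sweedler_tens_ident bcomul_tspace)
  qed
  ultimately show ?thesis unfolding comod_alg_iso_def by blast
qed

end

section \<open>Correcting a parametrization to a section\<close>

locale unital_parametrization = braided_comodule_algebra H B E
  for H :: "('k::field, 'h::ab_group_add) hopf" and B :: "('k, 'h, 'b::ab_group_add) bhopf"
    and E :: "('k, 'h, 'e::ab_group_add, 'b) comod_alg" +
  fixes l :: "'b \<Rightarrow> 'e" and \<epsilon>0 :: "'e \<Rightarrow> 'k"
  assumes lin_l: "lin B E l" and bij_l: "bij l" and l_bone: "l (bone B) = cone E"
    and lin_\<epsilon>0: "lin E ground \<epsilon>0" and \<epsilon>0_l: "\<epsilon>0 (l b) = bcounit B b"
begin

definition contract :: "('k, 'e, 'b) tensor \<Rightarrow> 'e" where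
  "contract t = sweedler E B t (\<lambda>e b. scale E (\<epsilon>0 e) (l b))"

definition slice_deviation :: "'b \<Rightarrow> 'b" where
  "slice_deviation b = slice \<epsilon>0 (l b) - b"

lemma lin_slice_deviation: "lin B B slice_deviation"
  unfolding slice_deviation_def[abs_def]
  by (intro lin_intros lin_compose[OF lin_slice[OF lin_\<epsilon>0]] lin_l)

lemma slice_l: "slice \<epsilon>0 (l b) = slice_deviation b + b"
  by (simp add: slice_deviation_def)

lemma contract_rho: "contract (rho E e) = l (slice \<epsilon>0 e)"
  by (simp add: contract_def slice_def lin_sweedler[OF lin_l] lin_scale[OF lin_l])

lemma lin_contract_rho: "lin E E (\<lambda>e. contract (rho E e))"
  unfolding contract_rho by (intro lin_compose[OF lin_l] lin_slice lin_\<epsilon>0)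

lemma colinear_defect_contraction:
  assumes F: "lin B X F"
  shows "sweedler E B (colinear_defect l b) (\<lambda>e c. scale X (\<epsilon>0 e) (F c)) = F (slice_deviation b)"
proof -
  have "vspace X" using F by (simp add: lin_iff)
  then have bilin: "bilin E B X (\<lambda>e c. scale X (\<epsilon>0 e) (F c))"
    by (intro lin_intros lin_compose[OF lin_\<epsilon>0] lin_compose[OF F])
  show ?thesis
    unfolding sweedler_colinear_defect[OF bilin] \<epsilon>0_l bcounit_left[OF F]
    by (simp add: slice_deviation_def lin_diff[OF F] slice_def lin_sweedler[OF F] lin_scale[OF F])
qed

lemma contract_colinear_defect: "contract (colinear_defect l b) = l (slice_deviation b)"
  unfolding contract_def by (rule colinear_defect_contraction[OF lin_l])

lemma slice_deviation_bone: "slice_deviation (bone B) = 0"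
proof -
  have "bilin E B B (\<lambda>e c. scale B (\<epsilon>0 e) c)" by (intro lin_intros lin_compose[OF lin_\<epsilon>0])
  then have "slice \<epsilon>0 (cone E) = scale B (\<epsilon>0 (cone E)) (bone B)"
    by (simp add: slice_def rho_cone sweedler_tens)
  then show ?thesis
    using \<epsilon>0_l[of "bone B"] by (simp add: slice_deviation_def l_bone bcounit_bone scale_one)
qed

lemma bcounit_slice_deviation: "bcounit B (slice_deviation b) = 0"
proof -
  have "bcounit B (slice \<epsilon>0 (l b)) = SE (l b) (\<lambda>e c. scale ground (bcounit B c) (\<epsilon>0 e))"
    unfolding slice_def lin_sweedler[OF lin_bcounit] lin_scale[OF lin_bcounit]
    by (simp add: mult.commute)
  also have "\<dots> = bcounit B b" by (simp only: rho_counit[OF lin_\<epsilon>0] \<epsilon>0_l)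
  finally show ?thesis by (simp add: slice_deviation_def lin_diff[OF lin_bcounit])
qed

lemma tmap_contract_colinear_defect:
  "tmap E B E B (\<lambda>e. contract (rho E e)) id (colinear_defect l b)
    = tmap B B E B l id (bcomul B (slice_deviation b))
      - tmap B B E B (\<lambda>x. l (slice_deviation x)) id (bcomul B b)"
proof -
  let ?L = "\<lambda>t. tmap B B E B l id t" and ?C = "\<lambda>t. tmap E B E B (\<lambda>e. contract (rho E e)) id t"
  have "?C (rho E (l b)) = ?L (tmap E B B B (slice \<epsilon>0) id (rho E (l b)))"
    by (simp add: tmap_id_tmap[OF lin_l] contract_rho)
  also have "\<dots> = ?L (bcomul B (slice_deviation b + b))"
    by (simp only: bcomul_slice[OF lin_\<epsilon>0, symmetric] slice_l)
  also have "\<dots> = ?L (bcomul B (slice_deviation b)) + ?L (bcomul B b)"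
    by (rule lin_add[OF lin_tmap_id_bcomul[OF lin_l]])
  finally have rho_part: "?C (rho E (l b)) = \<dots>" .
  have "?C (?L (bcomul B b)) = tmap B B E B (\<lambda>x. contract (rho E (l x))) id (bcomul B b)"
    by (simp add: tmap_id_tmap[OF lin_contract_rho])
  then have comul_part: "tmap B B E B (\<lambda>x. l (slice_deviation x)) id (bcomul B b)
      = ?C (?L (bcomul B b)) - ?L (bcomul B b)"
    by (simp add: tmap_fun_diff[symmetric] contract_rho slice_l lin_add[OF lin_l])
  have "bilin E B TT (\<lambda>e c. tens E B (contract (rho E e)) (id c))"
    by (rule bilin_tens_compose[OF lin_contract_rho lin_id[OF vspace_B]])
  from sweedler_tensor_diff[OF this rho_tspace tmap_in_tspace]
  have "?C (colinear_defect l b) = ?C (rho E (l b)) - ?C (?L (bcomul B b))"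
    by (simp add: tmap_def[of E B E B] colinear_defect_def)
  then show ?thesis unfolding rho_part comul_part by simp
qed

end

locale section_correction = unital_parametrization H B E l \<epsilon>0
  for H :: "('k::field, 'h::ab_group_add) hopf" and B :: "('k, 'h, 'b::ab_group_add) bhopf"
    and E :: "('k, 'h, 'e::ab_group_add, 'b) comod_alg"
    and l :: "'b \<Rightarrow> 'e" and \<epsilon>0 :: "'e \<Rightarrow> 'k" +
  fixes BB :: "'b set" and \<omega> :: "'b \<Rightarrow> 'e"
  assumes basis: "is_basis B BB" and lin_\<omega>: "lin B E \<omega>"
    and \<omega>_on_basis: "b \<in> BB \<Longrightarrow> \<omega> b = l b - contract (colinear_defect l b)"
    and defect_invariant_on_basis: "b \<in> BB \<Longrightarrow>
      tmap E B E B (\<lambda>e. contract (rho E e)) id (colinear_defect l b) = colinear_defect l b"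
    and defect_contraction_on_basis: "b \<in> BB \<Longrightarrow>
      sweedler E B (colinear_defect l b) (\<lambda>e c. scale TT (\<epsilon>0 e) (colinear_defect l c)) = 0"
begin

lemma \<omega>_eq: "\<omega> b = l (b - slice_deviation b)"
proof (rule lin_eq_on_basis[OF basis lin_\<omega>])
  show "lin B E (\<lambda>b. l (b - slice_deviation b))"
    by (intro lin_compose[OF lin_l] lin_fun_diff lin_ident lin_slice_deviation vspace_B)
qed (simp add: \<omega>_on_basis contract_colinear_defect lin_diff[OF lin_l])

lemma defect_invariant:
  "tmap E B E B (\<lambda>e. contract (rho E e)) id (colinear_defect l b) = colinear_defect l b"
proof (rule lin_eq_on_basis[OF basis])
  show "lin B TT (\<lambda>b. tmap E B E B (\<lambda>e. contract (rho E e)) id (colinear_defect l b))"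
    by (intro lin_tmap lin_colinear_defect lin_l colinear_defect_tspace lin_contract_rho lin_id
        vspace_B)
qed (intro lin_colinear_defect lin_l defect_invariant_on_basis)+

lemma defect_slice_deviation: "colinear_defect l (slice_deviation b) = 0"
proof (rule lin_eq_on_basis[OF basis, where g = "\<lambda>_. 0"
      and f = "\<lambda>b. colinear_defect l (slice_deviation b)"])
  note lin_defect = lin_colinear_defect[OF lin_l]
  show "lin B TT (\<lambda>b. colinear_defect l (slice_deviation b))"
    by (rule lin_compose[OF lin_defect lin_slice_deviation])
  show "lin B TT (\<lambda>_. 0)" by (intro lin_const_zero vspace_B vspace_TT)
  fix b assume "b \<in> BB"
  then show "colinear_defect l (slice_deviation b) = 0"
    using defect_contraction_on_basis colinear_defect_contraction[OF lin_defect] by simp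
qed

lemma slice_deviation_square: "slice_deviation (slice_deviation b) = 0"
proof -
  have "bilin E B B (\<lambda>e c. scale B (\<epsilon>0 e) c)" by (intro lin_intros lin_compose[OF lin_\<epsilon>0])
  then show ?thesis
    using colinear_defect_contraction[OF lin_ident[OF vspace_B], of "slice_deviation b"]
    by (simp add: defect_slice_deviation sweedler_tensor_zero)
qed

lemma bij_\<omega>: "bij \<omega>"
proof -
  note lin = lin_slice_deviation
  have "bij (\<lambda>b. b - slice_deviation b)"
    by (rule o_bij[of "\<lambda>b. b + slice_deviation b"])
      (auto simp: fun_eq_iff lin_diff[OF lin] lin_add[OF lin] slice_deviation_square)
  from bij_comp[OF this bij_l] show ?thesis by (simp add: comp_def \<omega>_eq[abs_def])
qed

lemma \<omega>_bone: "\<omega> (bone B) = cone E"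
  by (simp add: \<omega>_eq slice_deviation_bone l_bone)

lemma \<epsilon>0_\<omega>: "\<epsilon>0 (\<omega> b) = bcounit B b"
  by (simp add: \<omega>_eq \<epsilon>0_l lin_diff[OF lin_bcounit] bcounit_slice_deviation)

lemma colinear_\<omega>: "colinear \<omega>"
  unfolding colinear_def
proof
  fix b
  let ?L = "\<lambda>f b. tmap B B E B f id (bcomul B b)" and ?n = "slice_deviation"
  have rho_l: "rho E (l c) = colinear_defect l c + ?L l c" for c
    by (simp add: colinear_defect_def)
  have "rho E (\<omega> b) = rho E (l b) - rho E (l (?n b))"
    by (simp add: \<omega>_eq lin_diff[OF lin_l] lin_diff[OF lin_rho])
  also have "\<dots> = colinear_defect l b + ?L l b - ?L l (?n b)"
    by (simp add: rho_l defect_slice_deviation)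
  also have "colinear_defect l b = ?L l (?n b) - ?L (\<lambda>x. l (?n x)) b"
    using defect_invariant[of b] by (simp only: tmap_contract_colinear_defect)
  also have "\<dots> + ?L l b - ?L l (?n b) = ?L \<omega> b"
    by (simp add: \<omega>_eq[abs_def] lin_diff[OF lin_l] tmap_fun_diff)
  finally show "rho E (\<omega> b) = ?L \<omega> b" .
qed

lemma is_cleft_section:
  assumes "cleft_object H B E" "h_linear B E \<omega>" shows "cleft_section H B E \<omega> \<epsilon>0"
proof
  obtain \<gamma> where "lin B E \<gamma>" "bij \<gamma>" "colinear \<gamma>" "conv_invertible B E \<gamma>"
    using assms(1) by (auto simp: cleft_object_def h_linear_def colinear_def)
  then show "conv_invertible B E \<omega>"
    by (rule colinear_bij_conv_invertible[OF _ _ _ _ lin_\<omega> bij_\<omega> colinear_\<omega>])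
qed (rule assms(2) bij_\<omega> \<omega>_bone colinear_\<omega> lin_\<epsilon>0 \<epsilon>0_\<omega>)+

end

section \<open>Noncommutative polynomials in graded algebras\<close>

lemma alg_hom_nc_eval:
  assumes "alg_hom A m u C m' u' f"
  shows "f (nc_eval A m u z p) = nc_eval C m' u' (\<lambda>i. f (z i)) p"
proof -
  have lin: "lin A C f" and mult: "\<And>a b. f (m a b) = m' (f a) (f b)" "f u = u'"
    using assms by (auto simp: alg_hom_def)
  have "f (\<Sum>x\<in>S. g x) = (\<Sum>x\<in>S. f (g x))" if "finite S" for S :: "nat list set" and g
    using that by (induction S) (auto simp: lin_zero[OF lin] lin_add[OF lin])
  moreover have "f (foldr (\<lambda>i. m (z i)) w u) = foldr (\<lambda>i. m' (f (z i))) w u'" for w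
    by (induction w) (auto simp: mult)
  ultimately show ?thesis by (simp add: nc_eval_def lin_scale[OF lin])
qed

lemma alg_hom_nc_eval_on_basis:
  assumes "is_basis B S" "alg_hom A m u C m' u' f" "lin B A s" "lin B C g"
    and "\<And>b. b \<in> S \<Longrightarrow> s b = nc_eval A m u z (p b)"
    and "\<And>b. b \<in> S \<Longrightarrow> g b = nc_eval C m' u' (\<lambda>i. f (z i)) (p b)"
  shows "f (s b) = g b"
proof (rule lin_eq_on_basis[OF assms(1)])
  have "lin A C f" using assms(2) by (simp add: alg_hom_def)
  then show "lin B C (\<lambda>b. f (s b))" by (rule lin_compose) (rule assms(3))
qed (use assms in \<open>simp_all add: alg_hom_nc_eval\<close>)

lemma nc_eval_degree_0:
  assumes "nc_homogeneous \<theta> 0 p" "vspace A"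
  shows "nc_eval A m u z p = scale A (Poly_Mapping.lookup p []) u"
proof -
  have keys: "Poly_Mapping.keys p \<subseteq> {[]}" using assms(1) by (auto simp: nc_homogeneous_def)
  then have "nc_eval A m u z p = (\<Sum>w\<in>{[]}. scale A (Poly_Mapping.lookup p w)
      (foldr (\<lambda>i. m (z i)) w u))"
    unfolding nc_eval_def
    by (intro sum.mono_neutral_left) (auto simp: in_keys_iff scale_zero_left assms(2))
  then show ?thesis by simp
qed

lemma
  assumes "graded_braided_hopf H A"
  shows graded_braided: "braided_hopf H A"
    and graded_vspace: "vspace A"
    and graded_coalgebra: "coalgebra A (bcomul A) (bcounit A)"
    and graded_subspace: "is_subspace A (grade A n)"
    and graded_bone: "bone A \<in> grade A 0"
    and graded_bmul: "a \<in> grade A i \<Longrightarrow> b \<in> grade A j \<Longrightarrow> bmul A a b \<in> grade A (i + j)"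
    and graded_bmul_bone: "bmul A a (bone A) = a"
    and graded_bcomul_bone: "bcomul A (bone A) = tens A A (bone A) (bone A)"
    and graded_bcounit_bone: "bcounit A (bone A) = 1"
    and graded_bcounit_positive: "0 < n \<Longrightarrow> a \<in> grade A n \<Longrightarrow> bcounit A a = 0"
  using assms by (auto simp: graded_braided_hopf_def braided_hopf_def coalgebra_def
      h_module_algebra_def assoc_algebra_def)

lemma nc_eval_grade:
  assumes A: "graded_braided_hopf H A" and z: "\<And>i. i \<in> {1..\<theta>} \<Longrightarrow> z i \<in> grade A 1"
    and p: "nc_homogeneous \<theta> n p"
  shows "nc_eval A (bmul A) (bone A) z p \<in> grade A n"
proof -
  interpret vector_space "scale A" using graded_vspace[OF A] by (simp add: vspace_def)
  have subspace: "subspace (grade A n)"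
    using graded_subspace[OF A] by (simp add: is_subspace_def)
  have "foldr (\<lambda>i. bmul A (z i)) w (bone A) \<in> grade A (length w)" if "set w \<subseteq> {1..\<theta>}" for w
    using that
  proof (induction w)
    case Nil
    then show ?case using graded_bone[OF A] by simp
  next
    case (Cons i w)
    then show ?case using graded_bmul[OF A z, of i _ "length w"] by simp
  qed
  then show ?thesis
    using p unfolding nc_eval_def nc_homogeneous_def
    by (intro subspace_sum subspace_scale subspace) auto
qed

definition scalar_or_positive_degree ::
    "('k::field, 'h::ab_group_add, 'a::ab_group_add, 'm) bhopf_scheme \<Rightarrow> 'a \<Rightarrow> bool" where
  "scalar_or_positive_degree A a \<longleftrightarrow> (\<exists>c. a = scale A c (bone A)) \<or> (\<exists>n>0. a \<in> grade A n)"

lemma scalar_or_positive_degree_nc_eval: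
  assumes A: "graded_braided_hopf H A" and z: "\<And>i. i \<in> {1..\<theta>} \<Longrightarrow> z i \<in> grade A 1"
    and p: "nc_homogeneous \<theta> n p"
  shows "scalar_or_positive_degree A (nc_eval A (bmul A) (bone A) z p)"
proof (cases "n = 0")
  case True
  then have "nc_homogeneous \<theta> 0 p" using p by simp
  from nc_eval_degree_0[OF this graded_vspace[OF A]] show ?thesis
    unfolding scalar_or_positive_degree_def by blast
next
  case False
  then show ?thesis
    using nc_eval_grade[OF A z p] by (auto simp: scalar_or_positive_degree_def)
qed

lemma tensor_algebra_generator_grade:
  assumes T: "tensor_algebra H V \<theta> x T j" and i: "i \<in> {1..\<theta>}"
  shows "j (x i) \<in> grade T 1"
proof -
  let ?word = "\<lambda>w. foldr (\<lambda>i. bmul T (j (x i))) w (bone T)"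
  have graded: "graded_braided_hopf H T"
    and grade: "grade T 1 = vspan T (?word ` {w. set w \<subseteq> {1..\<theta>} \<and> length w = 1})"
    using T unfolding tensor_algebra_def Let_def by blast+
  interpret vector_space "scale T" using graded_vspace[OF graded] by (simp add: vspace_def)
  have "?word [i] \<in> grade T 1"
    unfolding grade vspan_def by (rule span_base, rule imageI) (use i in auto)
  then show ?thesis by (simp add: graded_bmul_bone[OF graded])
qed

lemma pre_nichols_generator_grade:
  assumes "tensor_algebra H V \<theta> x T jT" "pre_nichols H T jT B jB A q \<pi>" "i \<in> {1..\<theta>}"
  shows "q (jT (x i)) \<in> grade A 1"
proof -
  have "q ` grade T n \<subseteq> grade A n" for n
    using assms(2) by (simp add: pre_nichols_def graded_bhopf_hom_def)
  from subsetD[OF this imageI[OF tensor_algebra_generator_grade[OF assms(1,3)]]] show ?thesis .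
qed

lemma pre_nichols_nc_eval:
  assumes T: "tensor_algebra H V \<theta> x T jT" and A: "pre_nichols H T jT B jB A q \<pi>"
    and p: "nc_homogeneous \<theta> n p"
  shows "scalar_or_positive_degree A (nc_eval A (bmul A) (bone A) (\<lambda>i. q (jT (x i))) p)"
proof -
  have "graded_braided_hopf H A" using A by (simp add: pre_nichols_def)
  from scalar_or_positive_degree_nc_eval[OF this pre_nichols_generator_grade[OF T A] p]
  show ?thesis .
qed

lemma homogeneous_section_bone:
  assumes A: "graded_braided_hopf H A" and B: "graded_braided_hopf H B"
    and \<pi>: "graded_bhopf_hom H A B \<pi>" and basis: "is_basis B BB"
    and \<iota>: "lin B A \<iota>" "\<And>b. \<pi> (\<iota> b) = b" "\<And>b. b \<in> BB \<Longrightarrow> scalar_or_positive_degree A (\<iota> b)"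
  shows "\<iota> (bone B) = bone A"
proof -
  have lin_\<pi>: "lin A B \<pi>" and \<pi>_one: "\<pi> (bone A) = bone B" and \<pi>_grade: "\<pi> ` grade A n \<subseteq> grade B n"
    and lin_counit: "lin B ground (bcounit B)" for n
    using \<pi> graded_coalgebra[OF B]
    by (auto simp: graded_bhopf_hom_def alg_hom_def coalgebra_def)
  obtain b where b: "b \<in> BB" "bcounit B b \<noteq> 0"
    using lin_nonzero_on_basis[OF basis lin_counit, of "bone B"] graded_bcounit_bone[OF B]
    by auto
  have "\<not> (\<exists>n>0. \<iota> b \<in> grade A n)"
  proof
    assume "\<exists>n>0. \<iota> b \<in> grade A n"
    then obtain n where "n > 0" "\<pi> (\<iota> b) \<in> grade B n" using \<pi>_grade by blast
    then show False using b(2) graded_bcounit_positive[OF B] by (simp add: \<iota>(2))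
  qed
  then obtain c where c: "\<iota> b = scale A c (bone A)"
    using \<iota>(3)[OF b(1)] unfolding scalar_or_positive_degree_def by blast
  have b_eq: "b = scale B c (bone B)"
    using arg_cong[OF c, of \<pi>] by (simp add: \<iota>(2) lin_scale[OF lin_\<pi>] \<pi>_one)
  then have "c \<noteq> 0" using b(2) by (auto simp: lin_scale[OF lin_counit])
  interpret vector_space "scale A" using graded_vspace[OF A] by (simp add: vspace_def)
  have "scale A c (\<iota> (bone B)) = scale A c (bone A)"
    using c unfolding b_eq lin_scale[OF \<iota>(1)] .
  with \<open>c \<noteq> 0\<close> show ?thesis by simp
qed

lemma reduced_comul_cases:
  assumes A: "graded_braided_hopf H A" and D: "reduced_comul A D"
    and "scalar_or_positive_degree A a"
  obtains c where "a = scale A c (bone A)" "D a = 0"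
  | "D a = bcomul A a - tens A A a (bone A) - tens A A (bone A) a"
proof -
  have lin: "lin A TT D" and "D (bone A) = 0"
    using D graded_bone[OF A] by (auto simp: reduced_comul_def)
  then have "D (scale A c (bone A)) = 0" for c
    by (simp add: lin_scale[OF lin] scale_zero_right vspace_TT)
  moreover have "D a = bcomul A a - tens A A a (bone A) - tens A A (bone A) a"
    if "n > 0" "a \<in> grade A n" for n
    using D that by (simp add: reduced_comul_def)
  ultimately show thesis using assms(3) that unfolding scalar_or_positive_degree_def by blast
qed

lemma reduced_comul_tspace:
  assumes A: "graded_braided_hopf H A" and "reduced_comul A D" "scalar_or_positive_degree A a"
  shows "D a \<in> tspace A A"
proof -
  have "bcomul A a \<in> tspace A A"
    using graded_coalgebra[OF A] by (simp add: coalgebra_def)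
  then show ?thesis
    using graded_vspace[OF A]
    by (cases rule: reduced_comul_cases[OF assms])
      (simp_all add: tens_in_tspace tspace_diff tspace_zero)
qed

lemma sweedler_reduced_comul:
  assumes A: "graded_braided_hopf H A" and "reduced_comul A D" "scalar_or_positive_degree A a"
    and F: "bilin A A X F" and "F a (bone A) = 0" "\<And>v. F (bone A) v = 0"
  shows "sweedler A A (D a) F = sweedler A A (bcomul A a) F"
  using assms(1-3)
proof (cases rule: reduced_comul_cases)
  case (1 c)
  have "lin A TT (bcomul A)" "bcomul A (bone A) = tens A A (bone A) (bone A)"
    using graded_coalgebra[OF A] graded_bcomul_bone[OF A] by (auto simp: coalgebra_def)
  then have "sweedler A A (bcomul A a) F = scale X c (F (bone A) (bone A))"
    using graded_vspace[OF A]
    by (simp add: 1(1) lin_scale sweedler_tensor_scale[OF F] tens_in_tspace sweedler_tens[OF F])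
  then show ?thesis
    by (simp add: 1(2) assms(6) sweedler_tensor_zero[OF F] scale_zero_right bilin_vspace(3)[OF F])
next
  case 2
  have "bcomul A a \<in> tspace A A"
    using graded_coalgebra[OF A] by (simp add: coalgebra_def)
  then show ?thesis
    using graded_vspace[OF A] assms(5,6)
    by (simp add: 2 sweedler_tensor_diff[OF F] tspace_diff tens_in_tspace sweedler_tens[OF F])
qed

section \<open>Parametrizations lifted to a pre-Nichols algebra\<close>

locale pre_nichols_lift = unital_parametrization H B E l \<epsilon>0
  for H :: "('k::field, 'h::ab_group_add) hopf" and B :: "('k, 'h, 'b::ab_group_add) bhopf"
    and E :: "('k, 'h, 'e::ab_group_add, 'b) comod_alg"
    and l :: "'b \<Rightarrow> 'e" and \<epsilon>0 :: "'e \<Rightarrow> 'k" +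
  fixes A :: "('k, 'h, 'a::ab_group_add) bhopf" and BB :: "'b set"
    and \<pi>B :: "'a \<Rightarrow> 'b" and \<pi>E :: "'a \<Rightarrow> 'e" and \<iota> :: "'b \<Rightarrow> 'a"
    and \<tau>1 \<tau>2 :: "'a \<Rightarrow> 'a" and rD :: "'a \<Rightarrow> ('k, 'a, 'a) tensor"
  assumes graded_A: "graded_braided_hopf H A" and basis: "is_basis B BB"
    and lin_\<pi>B: "lin A B \<pi>B" and lin_\<pi>E: "lin A E \<pi>E" and lin_\<iota>: "lin B A \<iota>"
    and bcomul_\<pi>B: "bcomul B (\<pi>B a) = tmap A A B B \<pi>B \<pi>B (bcomul A a)"
    and rho_\<pi>E: "rho E (\<pi>E a) = tmap A A E B \<pi>E \<pi>B (bcomul A a)"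
    and \<pi>B_\<iota>: "\<pi>B (\<iota> b) = b" and \<pi>E_\<iota>: "\<pi>E (\<iota> b) = l b" and \<iota>_bone: "\<iota> (bone B) = bone A"
    and \<iota>_homogeneous: "b \<in> BB \<Longrightarrow> scalar_or_positive_degree A (\<iota> b)"
    and decomposition: "a = \<tau>1 a + \<tau>2 a" "\<tau>1 a \<in> range \<iota>" "\<pi>B (\<tau>2 a) = 0"
    and reduced: "reduced_comul A rD"
begin

lemma \<tau>1_eq: "\<tau>1 a = \<iota> (\<pi>B a)"
proof -
  obtain c where c: "\<tau>1 a = \<iota> c" using decomposition(2) by blast
  have "\<pi>B a = \<pi>B (\<tau>1 a)"
    using arg_cong[OF decomposition(1), of \<pi>B a] by (simp add: lin_add[OF lin_\<pi>B] decomposition(3))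
  then show ?thesis by (simp add: c \<pi>B_\<iota>)
qed

lemma \<pi>E_\<tau>2: "\<pi>E (\<tau>2 a) = \<pi>E a - l (\<pi>B a)"
  using arg_cong[OF decomposition(1), of \<pi>E a] by (simp add: lin_add[OF lin_\<pi>E] \<tau>1_eq \<pi>E_\<iota>)

lemma lin_\<pi>E_\<tau>2: "lin A E (\<lambda>a. \<pi>E (\<tau>2 a))"
  unfolding \<pi>E_\<tau>2 by (intro lin_fun_diff lin_\<pi>E lin_compose[OF lin_l] lin_\<pi>B)

lemma \<pi>E_\<tau>2_\<iota>: "\<pi>E (\<tau>2 (\<iota> b)) = 0"
  by (simp add: \<pi>E_\<tau>2 \<pi>E_\<iota> \<pi>B_\<iota>)

definition reduced_defect :: "'a \<Rightarrow> ('k, 'e, 'b) tensor" where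
  "reduced_defect a = tmap A A E B (\<lambda>u. \<pi>E (\<tau>2 u)) \<pi>B (rD a)"

lemma lin_rD_\<iota>: "lin B TT (\<lambda>b. rD (\<iota> b))"
  by (rule lin_compose[OF _ lin_\<iota>]) (use reduced in \<open>simp add: reduced_comul_def\<close>)

lemma rD_\<iota>_tspace: "rD (\<iota> b) \<in> tspace A A"
proof (rule lin_in_subspace_on_basis[OF basis _ is_subspace_tspace])
  show "lin B TT (\<lambda>b. rD (\<iota> b))" by (rule lin_rD_\<iota>)
qed (rule reduced_comul_tspace[OF graded_A reduced \<iota>_homogeneous])

lemma tmap_comul_\<iota>:
  "tmap A A E B (\<lambda>u. \<pi>E (\<tau>2 u)) \<pi>B (bcomul A (\<iota> b)) = colinear_defect l b"
proof -
  have "rho E (l b) = tmap A A E B \<pi>E \<pi>B (bcomul A (\<iota> b))"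
    using rho_\<pi>E[of "\<iota> b"] by (simp add: \<pi>E_\<iota>)
  moreover have "tmap B B E B l id (bcomul B b)
      = tmap A A E B (\<lambda>u. l (\<pi>B u)) \<pi>B (bcomul A (\<iota> b))"
    using bcomul_\<pi>B[of "\<iota> b"] by (simp add: \<pi>B_\<iota> tmap_id_tmap[OF lin_l])
  ultimately show ?thesis
    by (simp add: colinear_defect_def \<pi>E_\<tau>2 tmap_fun_diff)
qed

lemma reduced_defect_\<iota>: "reduced_defect (\<iota> b) = colinear_defect l b"
proof (rule lin_eq_on_basis[OF basis])
  show "lin B TT (\<lambda>b. reduced_defect (\<iota> b))"
    unfolding reduced_defect_def by (intro lin_tmap lin_rD_\<iota> rD_\<iota>_tspace lin_\<pi>E_\<tau>2 lin_\<pi>B)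
  show "lin B TT (colinear_defect l)" by (rule lin_colinear_defect[OF lin_l])
  fix b assume b: "b \<in> BB"
  let ?F = "\<lambda>u v. tens E B (\<pi>E (\<tau>2 u)) (\<pi>B v)"
  have F_zero: "?F a c = 0" if "\<pi>E (\<tau>2 a) = 0" for a c
    unfolding that by (rule bilin_zero_left[OF bilin_tens[OF vspace_E vspace_B]])
  have "sweedler A A (rD (\<iota> b)) ?F = sweedler A A (bcomul A (\<iota> b)) ?F"
    using \<pi>E_\<tau>2_\<iota>[of "bone B"] unfolding \<iota>_bone
    by (intro sweedler_reduced_comul[OF graded_A reduced \<iota>_homogeneous[OF b]
        bilin_tens_compose[OF lin_\<pi>E_\<tau>2 lin_\<pi>B]] F_zero \<pi>E_\<tau>2_\<iota>)
  then show "reduced_defect (\<iota> b) = colinear_defect l b"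
    by (simp add: reduced_defect_def tmap_def flip: tmap_comul_\<iota>)
qed

lemma sweedler_rD_\<iota>:
  "sweedler A A (rD (\<iota> b)) (\<lambda>u v. scale TT (\<epsilon>0 (\<pi>E (\<tau>2 u))) (reduced_defect (\<tau>1 v)))
    = sweedler E B (colinear_defect l b) (\<lambda>e c. scale TT (\<epsilon>0 e) (colinear_defect l c))"
proof -
  let ?F = "\<lambda>e c. scale TT (\<epsilon>0 e) (colinear_defect l c)"
  have F: "bilin E B TT ?F"
    by (intro lin_intros lin_compose[OF lin_\<epsilon>0] lin_compose[OF lin_colinear_defect[OF lin_l]])
  have "sweedler E B (colinear_defect l b) ?F
      = sweedler A A (rD (\<iota> b)) (\<lambda>u v. ?F (\<pi>E (\<tau>2 u)) (\<pi>B v))"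
    by (simp only: reduced_defect_\<iota>[of b, symmetric] reduced_defect_def[of "\<iota> b"]
        sweedler_tmap[OF F])
  then show ?thesis by (simp add: \<tau>1_eq reduced_defect_\<iota>)
qed

end

lemma pre_nichols_lift_of_nc_basis:
  assumes hopf: "hopf_algebra H" and nichols: "nichols_algebra H V B jB"
    and comod_alg: "comodule_algebra H B E"
    and tensor: "tensor_algebra H V \<theta> x T jT" and pre: "pre_nichols H T jT B jB A q \<pi>B"
    and hom_\<pi>E: "alg_hom A (bmul A) (bone A) E (cmul E) (cone E) \<pi>E"
    and rho_\<pi>E: "\<And>a. rho E (\<pi>E a) = tmap A A E B \<pi>E \<pi>B (bcomul A a)"
    and basis: "is_basis B BB" and homogeneous: "\<And>b. b \<in> BB \<Longrightarrow> \<exists>n. nc_homogeneous \<theta> n (p b)"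
    and B_eval: "\<And>b. b \<in> BB \<Longrightarrow> b = nc_eval B (bmul B) (bone B) (\<lambda>i. jB (x i)) (p b)"
    and A_eval: "\<And>b. b \<in> BB \<Longrightarrow> \<iota> b = nc_eval A (bmul A) (bone A) (\<lambda>i. q (jT (x i))) (p b)"
    and E_eval:
      "\<And>b. b \<in> BB \<Longrightarrow> l b = nc_eval E (cmul E) (cone E) (\<lambda>i. \<pi>E (q (jT (x i)))) (p b)"
    and E_basis: "family_basis E BB l" and lin_l: "lin B E l" and lin_\<iota>: "lin B A \<iota>"
    and \<epsilon>0: "lin E ground \<epsilon>0" "\<And>b. \<epsilon>0 (l b) = bcounit B b"
    and decomposition: "\<And>a. a = \<tau>1 a + \<tau>2 a" "\<And>a. \<tau>1 a \<in> range \<iota>" "\<And>a. \<pi>B (\<tau>2 a) = 0"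
    and reduced: "reduced_comul A rD"
  shows "pre_nichols_lift H B E l \<epsilon>0 A BB \<pi>B \<pi>E \<iota> \<tau>1 \<tau>2 rD"
proof -
  have graded: "graded_braided_hopf H B" "graded_braided_hopf H A"
    and \<pi>B: "graded_bhopf_hom H A B \<pi>B" "\<And>v. \<pi>B (q (jT v)) = jB v"
    using nichols pre by (simp_all add: nichols_algebra_def pre_nichols_def)
  then have hom_\<pi>B: "alg_hom A (bmul A) (bone A) B (bmul B) (bone B) \<pi>B"
    by (simp add: graded_bhopf_hom_def)
  have \<pi>B_\<iota>: "\<pi>B (\<iota> b) = b" for b
    by (rule alg_hom_nc_eval_on_basis[OF basis hom_\<pi>B lin_\<iota> lin_ident A_eval])
      (simp_all add: graded_vspace[OF graded(1)] \<pi>B(2) flip: B_eval)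
  have \<pi>E_\<iota>: "\<pi>E (\<iota> b) = l b" for b
    by (rule alg_hom_nc_eval_on_basis[OF basis hom_\<pi>E lin_\<iota> lin_l A_eval E_eval])
  have \<iota>_homogeneous: "scalar_or_positive_degree A (\<iota> b)" if "b \<in> BB" for b
    using pre_nichols_nc_eval[OF tensor pre] homogeneous[OF that] A_eval[OF that] by metis
  have \<iota>_bone: "\<iota> (bone B) = bone A"
    by (rule homogeneous_section_bone[OF graded(2,1) \<pi>B(1) basis lin_\<iota> \<pi>B_\<iota> \<iota>_homogeneous])
  have l_bone: "l (bone B) = cone E"
    using hom_\<pi>E by (simp flip: \<pi>E_\<iota> add: \<iota>_bone alg_hom_def)
  show ?thesis
    using hopf graded comod_alg l_bone lin_l bij_on_family_basis[OF basis lin_l E_basis] \<epsilon>0 basis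
      hom_\<pi>B hom_\<pi>E rho_\<pi>E lin_\<iota> \<pi>B(1) \<pi>B_\<iota> \<pi>E_\<iota> \<iota>_bone \<iota>_homogeneous decomposition reduced
    by unfold_locales
      (simp_all add: graded_braided alg_hom_def graded_bhopf_hom_def)
qed

theorem theorem3p6:
  fixes H :: "('k::{alg_closed_field, field_char_0}, 'h::ab_group_add) hopf"
    and V :: "('k, 'h, 'v::ab_group_add) ydmod"
    and \<theta> :: nat and x :: "nat \<Rightarrow> 'v"
    and T :: "('k, 'h, 't::ab_group_add) bhopf" and jT :: "'v \<Rightarrow> 't"
    and B :: "('k, 'h, 'b::ab_group_add) bhopf" and jB :: "'v \<Rightarrow> 'b"
    and Bh :: "('k, 'h, 'a::ab_group_add) bhopf" and q :: "'t \<Rightarrow> 'a"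
    and E :: "('k, 'h, 'e::ab_group_add, 'b) comod_alg"
    and \<pi>B :: "'a \<Rightarrow> 'b" and \<pi>E :: "'a \<Rightarrow> 'e"
    and xh :: "nat \<Rightarrow> 'a" and y :: "nat \<Rightarrow> 'e"
    and BB :: "'b set" and p :: "'b \<Rightarrow> 'k ncpoly"
    and l :: "'b \<Rightarrow> 'e" and \<epsilon>0 :: "'e \<Rightarrow> 'k" and \<iota> :: "'b \<Rightarrow> 'a"
    and \<tau>1 \<tau>2 :: "'a \<Rightarrow> 'a"
    and rD :: "'a \<Rightarrow> ('k, 'a, 'a) tensor"
    and \<epsilon>0l :: "('k, 'e, 'b) tensor \<Rightarrow> 'e" and X :: "'a \<Rightarrow> ('k, 'e, 'b) tensor"
    and \<omega> :: "'b \<Rightarrow> 'e" and \<sigma> :: "'b \<Rightarrow> 'b \<Rightarrow> 'k"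
  assumes "hopf_algebra H" and "bij (hantip H)"
    and "yd_module H V" and "family_basis V {1..\<theta>} x"
    and "nichols_algebra H V B jB"
    and "cleft_object H B E"
    and "tensor_algebra H V \<theta> x T jT" and "pre_nichols H T jT B jB Bh q \<pi>B"
    and "alg_hom Bh (bmul Bh) (bone Bh) E (cmul E) (cone E) \<pi>E" and "surj \<pi>E"
    and "\<forall>a. rho E (\<pi>E a) = tmap Bh Bh E B \<pi>E \<pi>B (bcomul Bh a)"
    and xh: "\<And>i. xh i = q (jT (x i))" and y: "\<And>i. y i = \<pi>E (xh i)"
    and "is_basis B BB" and "\<forall>b\<in>BB. \<exists>n. b \<in> grade B n"
    and "\<forall>b\<in>BB. \<exists>n. nc_homogeneous \<theta> n (p b)"
    and "\<forall>b\<in>BB. b = nc_eval B (bmul B) (bone B) (\<lambda>i. jB (x i)) (p b)"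
    and "family_basis E BB (\<lambda>b. nc_eval E (cmul E) (cone E) y (p b))"
    and "lin B E l" and "\<forall>b\<in>BB. l b = nc_eval E (cmul E) (cone E) y (p b)"
    and "lin E ground \<epsilon>0" and "\<forall>b. \<epsilon>0 (l b) = bcounit B b"
    and "lin B Bh \<iota>" and "\<forall>b\<in>BB. \<iota> b = nc_eval Bh (bmul Bh) (bone Bh) xh (p b)"
    and "\<forall>a. a = \<tau>1 a + \<tau>2 a \<and> \<tau>1 a \<in> range \<iota> \<and> \<pi>B (\<tau>2 a) = 0"
    and "reduced_comul Bh rD"
    and \<epsilon>0l: "\<And>t. \<epsilon>0l t = sweedler E B t (\<lambda>e b. scale E (\<epsilon>0 e) (l b))"
    and X: "\<And>a. X a = tmap Bh Bh E B (\<lambda>u. \<pi>E (\<tau>2 u)) \<pi>B (rD a)"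
    and cond1: "\<forall>b\<in>BB. tmap E B E B (\<lambda>e. \<epsilon>0l (rho E e)) id (X (\<iota> b)) = X (\<iota> b)"
    and cond2: "\<forall>b\<in>BB. sweedler Bh Bh (rD (\<iota> b))
                  (\<lambda>u v. scale TT (\<epsilon>0 (\<pi>E (\<tau>2 u))) (X (\<tau>1 v))) = 0"
    and "lin B E \<omega>" and "\<forall>b\<in>BB. \<omega> b = l b - \<epsilon>0l (X (\<iota> b))"
    and \<sigma>: "\<And>a b. \<sigma> a b = \<epsilon>0 (cmul E (\<omega> a) (\<omega> b))"
    and "h_linear B E \<omega>"
  shows "\<sigma> \<in> Z2 H B \<and> comod_alg_iso B E (cocycle_twist H B \<sigma>)"
proof -
  have "comodule_algebra H B E" using assms(6) by (simp add: cleft_object_def)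
  moreover have "family_basis E BB l"
    using assms(18,20) by (simp cong: family_basis_cong)
  ultimately interpret pre_nichols_lift H B E l \<epsilon>0 Bh BB \<pi>B \<pi>E \<iota> \<tau>1 \<tau>2 rD
    using assms(11,14,16,17,19-26)
    by (intro pre_nichols_lift_of_nc_basis[OF assms(1,5) _ assms(7-9)])
      (auto simp: xh[abs_def] y[abs_def])
  have X_eq: "X = reduced_defect" and \<epsilon>0l_eq: "\<epsilon>0l = contract"
    by (intro ext, simp add: X reduced_defect_def \<epsilon>0l contract_def)+
  interpret section_correction H B E l \<epsilon>0 BB \<omega>
    using assms(31,32) cond1 cond2 basis
    by unfold_locales (simp_all add: X_eq \<epsilon>0l_eq sweedler_rD_\<iota> reduced_defect_\<iota>)
  interpret C: cleft_section H B E \<omega> \<epsilon>0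
    by (rule is_cleft_section) (fact assms(6,34))+
  have "\<sigma> = C.\<sigma>" by (intro ext) (simp add: \<sigma> C.\<sigma>_def)
  then show ?thesis using C.\<sigma>_in_Z2 C.comod_alg_iso_cocycle_twist by simp
qed

end
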